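(* Let $G$ be a finite group and $H$ a subgroup of $G$. Let $\mathcal T$ and $\pi$ be (finite-dimensional complex) linear representations of $G$ and $H$ respectively. Then $$\mathrm{Ind}^G_H\big((\mathcal T|_H)\otimes\pi\big)\;\cong\;\mathcal T\otimes\mathrm{Ind}^G_H\,\pi .$$
   Context: $\mathrm{Ind}^G_H$ denotes the induced representation, $\mathcal T|_H$ the restriction, and $\otimes$ the inner tensor product of representations. *)

theory Defs
  imports
    "HOL-Algebra.Bij"
    "HOL-Algebra.AbelCoset"
    "HOL-Library.Poly_Mapping"
    "Jordan_Normal_Form.VS_Connect"
begin

section \<open>Linear representations\<close>

text \<open>
  Complex vector spaces are vector spaces, in the sense of the locale \<^locale>\<open>vectorspace\<close>, over the
  field \<^term>\<open>class_ring :: complex ring\<close>. The record \<^typ>\<open>(complex, 'v) module\<close> extends that of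
  rings, so it has fields for a multiplication and a unit; they play no role here and
  are left undefined.
\<close>

definition GL :: "(complex, 'v) module \<Rightarrow> ('v \<Rightarrow> 'v) monoid" where
  "GL V = BijGroup (carrier V) \<lparr>carrier := Bij (carrier V) \<inter> LinearCombinations.module_hom class_ring V V\<rparr>"

record ('g, 'v) rep =
  rep_space :: "(complex, 'v) module"
  rep_act :: "'g \<Rightarrow> 'v \<Rightarrow> 'v"

locale linear_representation = group G + V: vectorspace class_ring "rep_space \<rho>"
  for G :: "('g, 'm) monoid_scheme" (structure) and \<rho> :: "('g, 'v) rep" +
  assumes finite_dimensional: "V.fin_dim"
    and act_hom: "rep_act \<rho> \<in> hom G (GL (rep_space \<rho>))"

definition rep_isomorphic ::
    "('g, 'm) monoid_scheme \<Rightarrow> ('g, 'v) rep \<Rightarrow> ('g, 'w) rep \<Rightarrow> bool" where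
  "rep_isomorphic G \<rho> \<sigma> \<longleftrightarrow>
    (\<exists>\<Phi>. \<Phi> \<in> LinearCombinations.module_hom class_ring (rep_space \<rho>) (rep_space \<sigma>)
       \<and> bij_betw \<Phi> (carrier (rep_space \<rho>)) (carrier (rep_space \<sigma>))
       \<and> (\<forall>g\<in>carrier G. \<forall>v\<in>carrier (rep_space \<rho>).
            \<Phi> (rep_act \<rho> g v) = rep_act \<sigma> g (\<Phi> v)))"

definition restrict_rep :: "'g set \<Rightarrow> ('g, 'v) rep \<Rightarrow> ('g, 'v) rep" where
  "restrict_rep H \<rho> = \<lparr>rep_space = rep_space \<rho>, rep_act = restrict (rep_act \<rho>) H\<rparr>"


section \<open>Induced representations\<close>

text \<open>
  The representation of \<open>G\<close> induced from a representation \<open>(\<pi>, W)\<close> of \<open>H\<close> is realised on the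
  functions \<open>f : G \<rightarrow> W\<close> with \<open>f (h x) = \<pi> h (f x)\<close>, on which \<open>G\<close> acts by right translation.
\<close>

definition induced_space ::
    "('g, 'm) monoid_scheme \<Rightarrow> 'g set \<Rightarrow> ('g, 'w) rep \<Rightarrow> (complex, 'g \<Rightarrow> 'w) module" where
  "induced_space G H \<pi> =
    \<lparr>carrier = {f \<in> carrier G \<rightarrow>\<^sub>E carrier (rep_space \<pi>).
        \<forall>h\<in>H. \<forall>x\<in>carrier G. f (h \<otimes>\<^bsub>G\<^esub> x) = rep_act \<pi> h (f x)},
     mult = undefined, one = undefined,
     zero = (\<lambda>x\<in>carrier G. \<zero>\<^bsub>rep_space \<pi>\<^esub>),
     add = (\<lambda>f f'. \<lambda>x\<in>carrier G. f x \<oplus>\<^bsub>rep_space \<pi>\<^esub> f' x),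
     smult = (\<lambda>c f. \<lambda>x\<in>carrier G. c \<odot>\<^bsub>rep_space \<pi>\<^esub> f x)\<rparr>"

definition induced_rep ::
    "('g, 'm) monoid_scheme \<Rightarrow> 'g set \<Rightarrow> ('g, 'w) rep \<Rightarrow> ('g, 'g \<Rightarrow> 'w) rep" where
  "induced_rep G H \<pi> =
    \<lparr>rep_space = induced_space G H \<pi>,
     rep_act = (\<lambda>g. \<lambda>f\<in>carrier (induced_space G H \<pi>). \<lambda>x\<in>carrier G. f (x \<otimes>\<^bsub>G\<^esub> g))\<rparr>"


section \<open>Tensor products\<close>

definition free_space :: "'a set \<Rightarrow> (complex, 'a \<Rightarrow>\<^sub>0 complex) module" where
  "free_space X =
    \<lparr>carrier = {p. Poly_Mapping.keys p \<subseteq> X}, mult = undefined, one = undefined,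
     zero = 0, add = (+), smult = (\<lambda>c. Poly_Mapping.map ((*) c))\<rparr>"

definition free_map :: "('a \<Rightarrow> 'b) \<Rightarrow> ('a \<Rightarrow>\<^sub>0 complex) \<Rightarrow> ('b \<Rightarrow>\<^sub>0 complex)" where
  "free_map h p =
    (\<Sum>x\<in>Poly_Mapping.keys p. Poly_Mapping.single (h x) (Poly_Mapping.lookup p x))"

text \<open>
  In the scalar multiplication of a coset \<open>A\<close> of a subspace, all representatives \<open>a\<close> give the same
  coset, so the union is that coset.
\<close>

definition quotient_space ::
    "(complex, 'v) module \<Rightarrow> 'v set \<Rightarrow> (complex, 'v set) module" where
  "quotient_space V N =
    \<lparr>carrier = a_rcosets\<^bsub>V\<^esub> N, mult = undefined, one = undefined,
     zero = N, add = set_add V,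
     smult = (\<lambda>c A. \<Union>a\<in>A. N +>\<^bsub>V\<^esub> (c \<odot>\<^bsub>V\<^esub> a))\<rparr>"

text \<open>
  The tensor product of \<open>V\<close> and \<open>W\<close> is the free vector space on \<open>V \<times> W\<close> modulo the bilinearity
  relations.
\<close>

definition bilinear_relations ::
    "(complex, 'v) module \<Rightarrow> (complex, 'w) module \<Rightarrow> ('v \<times> 'w \<Rightarrow>\<^sub>0 complex) set" where
  "bilinear_relations V W =
    (let e = (\<lambda>v w. Poly_Mapping.single (v, w) (1::complex)) in
      {e (v \<oplus>\<^bsub>V\<^esub> v') w - e v w - e v' w | v v' w.
         v \<in> carrier V \<and> v' \<in> carrier V \<and> w \<in> carrier W}
    \<union> {e v (w \<oplus>\<^bsub>W\<^esub> w') - e v w - e v w' | v w w'.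
         v \<in> carrier V \<and> w \<in> carrier W \<and> w' \<in> carrier W}
    \<union> {e (c \<odot>\<^bsub>V\<^esub> v) w - Poly_Mapping.single (v, w) c | c v w.
         v \<in> carrier V \<and> w \<in> carrier W}
    \<union> {e v (c \<odot>\<^bsub>W\<^esub> w) - Poly_Mapping.single (v, w) c | c v w.
         v \<in> carrier V \<and> w \<in> carrier W})"

definition tensor_kernel ::
    "(complex, 'v) module \<Rightarrow> (complex, 'w) module \<Rightarrow> ('v \<times> 'w \<Rightarrow>\<^sub>0 complex) set" where
  "tensor_kernel V W =
    LinearCombinations.module.span class_ring (free_space (carrier V \<times> carrier W))
      (bilinear_relations V W)"

definition tensor_space ::
    "(complex, 'v) module \<Rightarrow> (complex, 'w) module \<Rightarrow> (complex, ('v \<times> 'w \<Rightarrow>\<^sub>0 complex) set) module"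
  where
  "tensor_space V W =
    quotient_space (free_space (carrier V \<times> carrier W)) (tensor_kernel V W)"

text \<open>
  The linear map \<open>a \<otimes> b\<close> on \<open>V \<otimes> W\<close> sends the class of \<open>p\<close> to the class of the image of \<open>p\<close> under the
  linear extension of \<open>(v, w) \<mapsto> (a v, b w)\<close>; the union is over all representatives \<open>p\<close>, which give
  the same class when \<open>a\<close> and \<open>b\<close> are linear.
\<close>

definition tensor_map ::
    "(complex, 'v) module \<Rightarrow> (complex, 'w) module \<Rightarrow> ('v \<Rightarrow> 'v) \<Rightarrow> ('w \<Rightarrow> 'w)
      \<Rightarrow> ('v \<times> 'w \<Rightarrow>\<^sub>0 complex) set \<Rightarrow> ('v \<times> 'w \<Rightarrow>\<^sub>0 complex) set" where
  "tensor_map V W a b =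
    (\<lambda>A\<in>carrier (tensor_space V W).
      \<Union>p\<in>A. tensor_kernel V W
        +>\<^bsub>free_space (carrier V \<times> carrier W)\<^esub> free_map (map_prod a b) p)"

definition tensor_rep ::
    "('g, 'v) rep \<Rightarrow> ('g, 'w) rep \<Rightarrow> ('g, ('v \<times> 'w \<Rightarrow>\<^sub>0 complex) set) rep" where
  "tensor_rep \<rho> \<sigma> =
    \<lparr>rep_space = tensor_space (rep_space \<rho>) (rep_space \<sigma>),
     rep_act = (\<lambda>g. tensor_map (rep_space \<rho>) (rep_space \<sigma>) (rep_act \<rho> g) (rep_act \<sigma> g))\<rparr>"

end

theory Submission
  imports Defs
begin

text \<open>
  Write \<open>Ind\<close> for induction from \<open>H\<close> to \<open>G\<close>. In the model of \<open>Ind \<pi>\<close> by equivariant functions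
  \<open>f : G \<rightarrow> W\<close>, there is a natural map from \<open>\<T> \<otimes> Ind \<pi>\<close> to \<open>Ind (\<T>|\<^sub>H \<otimes> \<pi>)\<close>, which sends \<open>v \<otimes> f\<close> to
  the function \<open>x \<mapsto> \<T> x v \<otimes> f x\<close> (\<open>tensor_to_induced\<close>). The twist by \<open>\<T> x\<close> makes the values transform
  under \<open>H\<close> by \<open>\<T>|\<^sub>H \<otimes> \<pi>\<close>, and the map commutes with the action of \<open>G\<close>, because translating the function by \<open>g\<close>
  replaces \<open>x\<close> by \<open>x g\<close>, which amounts to applying \<open>\<T> g\<close> to \<open>v\<close> and translating \<open>f\<close>.

  This map has an explicit inverse (\<open>induced_to_tensor\<close>). For \<open>w\<close> in \<open>W\<close> let \<open>\<delta>\<^sub>x\<^sub>,\<^sub>w\<close> be the equivariant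
  function that is supported on the coset \<open>H x\<close> and has value \<open>w\<close> at \<open>x\<close> (\<open>coset_function\<close>). The linear map
  \<open>v \<otimes> w \<mapsto> \<T> (x\<inverse>) v \<otimes> \<delta>\<^sub>x\<^sub>,\<^sub>w\<close> (\<open>coset_extension\<close>) turns a value at \<open>x\<close> into an element of \<open>\<T> \<otimes> Ind \<pi>\<close>, and
  the inverse applies it to the value \<open>F x\<close>, sums over all \<open>x\<close> in \<open>G\<close> and divides by \<open>|H|\<close>, the
  number of times that each coset is counted. Both composites are the identity by
  \<open>coset_average\<close>: at a fixed \<open>y\<close>, exactly the \<open>|H|\<close> elements \<open>x\<close> of \<open>H y\<close> contribute, all of them
  the same value.

  These maps are linear and well defined by the universal property of the tensor product
  (\<open>tensor_lift_linear\<close>, \<open>tensor_lift_pure\<close>), and identities between them are checked on pure tensors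
  (\<open>tensor_linear_ext\<close>). Both facts are derived from the construction as a quotient of a free space.
\<close>

section \<open>Complex modules and linear maps\<close>

abbreviation complex_module :: "(complex, 'v) module \<Rightarrow> bool" where
  "complex_module V \<equiv> Module.module class_ring V"

abbreviation linear_maps ::
    "(complex, 'v) module \<Rightarrow> (complex, 'w) module \<Rightarrow> ('v \<Rightarrow> 'w) set" where
  "linear_maps V W \<equiv> LinearCombinations.module_hom class_ring V W"

lemma linear_mapI:
  assumes "\<And>v. v \<in> carrier V \<Longrightarrow> f v \<in> carrier W"
    and "\<And>u v. u \<in> carrier V \<Longrightarrow> v \<in> carrier V \<Longrightarrow> f (u \<oplus>\<^bsub>V\<^esub> v) = f u \<oplus>\<^bsub>W\<^esub> f v"
    and "\<And>c v. v \<in> carrier V \<Longrightarrow> f (c \<odot>\<^bsub>V\<^esub> v) = c \<odot>\<^bsub>W\<^esub> f v"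
  shows "f \<in> linear_maps V W"
  using assms unfolding LinearCombinations.module_hom_def by auto

lemma linear_map_closed: "f \<in> linear_maps V W \<Longrightarrow> v \<in> carrier V \<Longrightarrow> f v \<in> carrier W"
  unfolding LinearCombinations.module_hom_def by auto

lemma linear_map_add:
  "f \<in> linear_maps V W \<Longrightarrow> u \<in> carrier V \<Longrightarrow> v \<in> carrier V \<Longrightarrow>
    f (u \<oplus>\<^bsub>V\<^esub> v) = f u \<oplus>\<^bsub>W\<^esub> f v"
  unfolding LinearCombinations.module_hom_def by auto

lemma linear_map_smult:
  "f \<in> linear_maps V W \<Longrightarrow> v \<in> carrier V \<Longrightarrow> f (c \<odot>\<^bsub>V\<^esub> v) = c \<odot>\<^bsub>W\<^esub> f v"
  unfolding LinearCombinations.module_hom_def by auto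

lemma linear_map_zero:
  assumes "complex_module V" "complex_module W" "f \<in> linear_maps V W"
  shows "f \<zero>\<^bsub>V\<^esub> = \<zero>\<^bsub>W\<^esub>"
proof -
  interpret mod_hom class_ring V W f
    using assms by (simp add: mod_hom_def mod_hom_axioms_def)
  show ?thesis by (rule f0_is_0)
qed

lemma linear_map_uminus:
  assumes "complex_module V" "complex_module W" "f \<in> linear_maps V W" "v \<in> carrier V"
  shows "f (\<ominus>\<^bsub>V\<^esub> v) = \<ominus>\<^bsub>W\<^esub> f v"
proof -
  interpret mod_hom class_ring V W f
    using assms by (simp add: mod_hom_def mod_hom_axioms_def)
  show ?thesis using assms(4) by (rule f_neg)
qed

lemma linear_map_cong:
  assumes "complex_module V" and "f \<in> linear_maps V W"
    and "\<And>v. v \<in> carrier V \<Longrightarrow> f v = g v"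
  shows "g \<in> linear_maps V W"
proof -
  interpret V: Module.module class_ring V by fact
  have closed: "c \<odot>\<^bsub>V\<^esub> v \<in> carrier V" if "v \<in> carrier V" for c v
    using that by (intro V.smult_closed) simp_all
  note f = assms(2)
  show ?thesis
  proof (rule linear_mapI)
    fix u v c assume uv: "u \<in> carrier V" "v \<in> carrier V"
    show "g v \<in> carrier W"
      using uv linear_map_closed[OF f] assms(3)[of v] by metis
    show "g (u \<oplus>\<^bsub>V\<^esub> v) = g u \<oplus>\<^bsub>W\<^esub> g v"
      using uv linear_map_add[OF f uv] assms(3) V.a_closed by metis
    show "g (c \<odot>\<^bsub>V\<^esub> v) = c \<odot>\<^bsub>W\<^esub> g v"
      using uv linear_map_smult[OF f uv(2)] assms(3) closed by metis
  qed
qed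

lemma linear_map_id: "(\<lambda>v. v) \<in> linear_maps V V"
  by (rule linear_mapI) simp_all

lemma linear_map_compose:
  assumes "f \<in> linear_maps U V" "g \<in> linear_maps V W"
  shows "(\<lambda>u. g (f u)) \<in> linear_maps U W"
  using assms by (intro linear_mapI) (simp_all add: linear_map_closed linear_map_add linear_map_smult)

lemma linear_map_scaled:
  assumes "complex_module W" "f \<in> linear_maps V W"
  shows "(\<lambda>v. c \<odot>\<^bsub>W\<^esub> f v) \<in> linear_maps V W"
proof -
  interpret W: Module.module class_ring W by fact
  note f = assms(2)
  show ?thesis
  proof (rule linear_mapI)
    fix u v d assume uv: "u \<in> carrier V" "v \<in> carrier V"
    note fuv = linear_map_closed[OF f uv(1)] linear_map_closed[OF f uv(2)]
    show "c \<odot>\<^bsub>W\<^esub> f v \<in> carrier W"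
      using fuv by (intro W.smult_closed) simp_all
    show "c \<odot>\<^bsub>W\<^esub> f (u \<oplus>\<^bsub>V\<^esub> v) = c \<odot>\<^bsub>W\<^esub> f u \<oplus>\<^bsub>W\<^esub> c \<odot>\<^bsub>W\<^esub> f v"
      using fuv by (simp add: linear_map_add[OF f uv] W.smult_r_distr)
    show "c \<odot>\<^bsub>W\<^esub> f (d \<odot>\<^bsub>V\<^esub> v) = d \<odot>\<^bsub>W\<^esub> (c \<odot>\<^bsub>W\<^esub> f v)"
      using fuv W.smult_assoc1[of c d "f v"] W.smult_assoc1[of d c "f v"]
      by (simp add: linear_map_smult[OF f uv(2)] mult.commute)
  qed
qed

lemma linear_map_finsum:
  assumes "complex_module W" "finite A" "\<And>a. a \<in> A \<Longrightarrow> f a \<in> linear_maps V W"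
  shows "(\<lambda>v. \<Oplus>\<^bsub>W\<^esub>a\<in>A. f a v) \<in> linear_maps V W"
proof -
  interpret W: Module.module class_ring W by fact
  show ?thesis
  proof (rule linear_mapI)
    fix v assume v: "v \<in> carrier V"
    then show "(\<Oplus>\<^bsub>W\<^esub>a\<in>A. f a v) \<in> carrier W"
      by (intro W.finsum_closed) (auto intro: linear_map_closed assms(3))
    fix c
    have "(\<Oplus>\<^bsub>W\<^esub>a\<in>A. f a (c \<odot>\<^bsub>V\<^esub> v)) = (\<Oplus>\<^bsub>W\<^esub>a\<in>A. c \<odot>\<^bsub>W\<^esub> f a v)"
      using v by (intro W.finsum_cong')
        (simp_all add: Pi_def linear_map_smult[OF assms(3)] linear_map_closed[OF assms(3)])
    also have "\<dots> = c \<odot>\<^bsub>W\<^esub> (\<Oplus>\<^bsub>W\<^esub>a\<in>A. f a v)"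
      using v assms(2) by (intro W.finsum_smult_ldistr[symmetric])
        (auto intro: linear_map_closed assms(3))
    finally show "(\<Oplus>\<^bsub>W\<^esub>a\<in>A. f a (c \<odot>\<^bsub>V\<^esub> v)) = c \<odot>\<^bsub>W\<^esub> (\<Oplus>\<^bsub>W\<^esub>a\<in>A. f a v)" .
  next
    fix u v assume uv: "u \<in> carrier V" "v \<in> carrier V"
    have "(\<Oplus>\<^bsub>W\<^esub>a\<in>A. f a (u \<oplus>\<^bsub>V\<^esub> v)) = (\<Oplus>\<^bsub>W\<^esub>a\<in>A. f a u \<oplus>\<^bsub>W\<^esub> f a v)"
      using uv by (intro W.finsum_cong')
        (simp_all add: Pi_def linear_map_add[OF assms(3)] linear_map_closed[OF assms(3)])
    also have "\<dots> = (\<Oplus>\<^bsub>W\<^esub>a\<in>A. f a u) \<oplus>\<^bsub>W\<^esub> (\<Oplus>\<^bsub>W\<^esub>a\<in>A. f a v)"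
      using uv by (intro W.finsum_addf) (auto intro: linear_map_closed assms(3))
    finally show "(\<Oplus>\<^bsub>W\<^esub>a\<in>A. f a (u \<oplus>\<^bsub>V\<^esub> v)) = (\<Oplus>\<^bsub>W\<^esub>a\<in>A. f a u) \<oplus>\<^bsub>W\<^esub> (\<Oplus>\<^bsub>W\<^esub>a\<in>A. f a v)" .
  qed
qed

lemma linear_map_of_finsum:
  assumes "complex_module V" "complex_module W" "f \<in> linear_maps V W"
    and "finite A" "\<And>a. a \<in> A \<Longrightarrow> g a \<in> carrier V"
  shows "f (\<Oplus>\<^bsub>V\<^esub>a\<in>A. g a) = (\<Oplus>\<^bsub>W\<^esub>a\<in>A. f (g a))"
proof -
  interpret V: Module.module class_ring V by fact
  interpret W: Module.module class_ring W by fact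
  show ?thesis
    using assms(4,5)
  proof (induction A)
    case empty
    then show ?case using assms(1-3) by (simp add: linear_map_zero)
  next
    case (insert a A)
    have "f (\<Oplus>\<^bsub>V\<^esub>b\<in>insert a A. g b) = f (g a) \<oplus>\<^bsub>W\<^esub> f (\<Oplus>\<^bsub>V\<^esub>b\<in>A. g b)"
      using insert assms(3) by (subst V.finsum_insert)
        (auto simp: linear_map_add)
    also have "\<dots> = (\<Oplus>\<^bsub>W\<^esub>b\<in>insert a A. f (g b))"
      using insert assms(3) by (subst W.finsum_insert) (auto simp: linear_map_closed)
    finally show ?case .
  qed
qed

lemma complex_module_finsum_const:
  assumes "complex_module V" "v \<in> carrier V"
  shows "(\<Oplus>\<^bsub>V\<^esub>a\<in>A. v) = of_nat (card A) \<odot>\<^bsub>V\<^esub> v"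
proof -
  interpret V: Module.module class_ring V by fact
  show ?thesis
  proof (induction A rule: infinite_finite_induct)
    case (infinite A)
    then show ?case using assms V.finsum_infinite V.smult_l_null by simp
  next
    case empty
    then show ?case using assms V.smult_l_null by simp
  next
    case (insert a A)
    then show ?case
      using assms V.smult_l_distr[of 1 "of_nat (card A)" v] V.smult_one[of v]
      by (simp add: V.finsum_insert Pi_def)
  qed
qed

text \<open>
  The module axioms are equations between elements, so they pass from \<open>V\<close> to the image of any
  surjection that respects the operations. This spares checking them for cosets.
\<close>

lemma complex_module_surj_image:
  assumes "complex_module V"
    and surj: "f ` carrier V = carrier Q"
    and zero: "f \<zero>\<^bsub>V\<^esub> = \<zero>\<^bsub>Q\<^esub>"
    and add: "\<And>u v. u \<in> carrier V \<Longrightarrow> v \<in> carrier V \<Longrightarrow> f u \<oplus>\<^bsub>Q\<^esub> f v = f (u \<oplus>\<^bsub>V\<^esub> v)"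
    and smult: "\<And>c v. v \<in> carrier V \<Longrightarrow> c \<odot>\<^bsub>Q\<^esub> f v = f (c \<odot>\<^bsub>V\<^esub> v)"
  shows "complex_module Q"
proof -
  interpret V: Module.module class_ring V by fact
  have closed: "c \<odot>\<^bsub>V\<^esub> v \<in> carrier V" if "v \<in> carrier V" for c v
    using that by (intro V.smult_closed) simp_all
  have Q: "\<exists>u\<in>carrier V. w = f u" if "w \<in> carrier Q" for w
    using that surj by blast
  have f: "f v \<in> carrier Q" if "v \<in> carrier V" for v
    using that surj by blast
  show ?thesis
  proof (rule moduleI)
    show "abelian_group Q"
    proof (rule abelian_groupI)
      fix x y z assume "x \<in> carrier Q" "y \<in> carrier Q" "z \<in> carrier Q"
      then obtain u v w where "u \<in> carrier V" "v \<in> carrier V" "w \<in> carrier V"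
        and "x = f u" "y = f v" "z = f w"
        by (metis Q)
      then show "x \<oplus>\<^bsub>Q\<^esub> y \<in> carrier Q"
        and "x \<oplus>\<^bsub>Q\<^esub> y \<oplus>\<^bsub>Q\<^esub> z = x \<oplus>\<^bsub>Q\<^esub> (y \<oplus>\<^bsub>Q\<^esub> z)"
        and "x \<oplus>\<^bsub>Q\<^esub> y = y \<oplus>\<^bsub>Q\<^esub> x"
        by (simp_all add: add f V.a_ac)
    next
      show "\<zero>\<^bsub>Q\<^esub> \<in> carrier Q"
        using f[OF V.zero_closed] zero by simp
    next
      fix x assume "x \<in> carrier Q"
      then obtain u where u: "u \<in> carrier V" "x = f u"
        by (metis Q)
      then show "\<zero>\<^bsub>Q\<^esub> \<oplus>\<^bsub>Q\<^esub> x = x"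
        using add[OF V.zero_closed u(1)] by (simp add: zero)
      have "f (\<ominus>\<^bsub>V\<^esub> u) \<oplus>\<^bsub>Q\<^esub> x = \<zero>\<^bsub>Q\<^esub>"
        using u by (simp add: add V.l_neg zero)
      then show "\<exists>y\<in>carrier Q. y \<oplus>\<^bsub>Q\<^esub> x = \<zero>\<^bsub>Q\<^esub>"
        using f[OF V.a_inv_closed[OF u(1)]] by blast
    qed
  next
    fix a b :: complex and x y assume "x \<in> carrier Q" "y \<in> carrier Q"
    then obtain u v where uv: "u \<in> carrier V" "v \<in> carrier V" and xy: "x = f u" "y = f v"
      by (metis Q)
    show "a \<odot>\<^bsub>Q\<^esub> x \<in> carrier Q"
      using uv by (simp add: xy smult closed f)
    show "(a \<oplus>\<^bsub>class_ring\<^esub> b) \<odot>\<^bsub>Q\<^esub> x = a \<odot>\<^bsub>Q\<^esub> x \<oplus>\<^bsub>Q\<^esub> b \<odot>\<^bsub>Q\<^esub> x"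
      using uv V.smult_l_distr[of a b u] by (simp add: xy smult add closed)
    show "a \<odot>\<^bsub>Q\<^esub> (x \<oplus>\<^bsub>Q\<^esub> y) = a \<odot>\<^bsub>Q\<^esub> x \<oplus>\<^bsub>Q\<^esub> a \<odot>\<^bsub>Q\<^esub> y"
      using uv by (simp add: xy smult add closed V.smult_r_distr)
    show "(a \<otimes>\<^bsub>class_ring\<^esub> b) \<odot>\<^bsub>Q\<^esub> x = a \<odot>\<^bsub>Q\<^esub> (b \<odot>\<^bsub>Q\<^esub> x)"
      using uv V.smult_assoc1[of a b u] by (simp add: xy smult closed)
    show "\<one>\<^bsub>class_ring\<^esub> \<odot>\<^bsub>Q\<^esub> x = x"
      using uv V.smult_one[of u] by (simp add: xy smult)
  qed (rule class_cring.cring_axioms)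
qed

section \<open>Free spaces\<close>

lemma keys_scaled: "Poly_Mapping.keys (Poly_Mapping.map ((*) c) p) \<subseteq> Poly_Mapping.keys p"
  for c :: complex
  by (auto simp: in_keys_iff Poly_Mapping.map.rep_eq when_def split: if_splits)

lemma lookup_scaled:
  "Poly_Mapping.lookup (Poly_Mapping.map ((*) c) p) x = c * Poly_Mapping.lookup p x"
  for c :: complex
  by (simp add: Poly_Mapping.map.rep_eq when_def)

lemma free_space_simps [simp]:
  "carrier (free_space X) = {p. Poly_Mapping.keys p \<subseteq> X}"
  "\<zero>\<^bsub>free_space X\<^esub> = 0"
  "p \<oplus>\<^bsub>free_space X\<^esub> q = p + q"
  "c \<odot>\<^bsub>free_space X\<^esub> p = Poly_Mapping.map ((*) c) p"
  by (simp_all add: free_space_def)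

lemma free_space_add_closed:
  "Poly_Mapping.keys p \<subseteq> X \<Longrightarrow> Poly_Mapping.keys q \<subseteq> X \<Longrightarrow> Poly_Mapping.keys (p + q) \<subseteq> X"
  using Poly_Mapping.keys_add[of p q] by blast

lemma free_space_module: "complex_module (free_space X)"
proof (rule moduleI)
  show "abelian_group (free_space X)"
  proof (rule abelian_groupI)
    fix p assume "p \<in> carrier (free_space X)"
    then show "\<exists>q\<in>carrier (free_space X). q \<oplus>\<^bsub>free_space X\<^esub> p = \<zero>\<^bsub>free_space X\<^esub>"
      by (intro bexI[of _ "- p"]) (auto simp: in_keys_iff)
  qed (simp_all add: ac_simps free_space_add_closed)
next
  fix a b :: complex and p q assume p: "p \<in> carrier (free_space X)"
  then show "a \<odot>\<^bsub>free_space X\<^esub> p \<in> carrier (free_space X)"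
    using keys_scaled by fastforce
qed (auto intro!: poly_mapping_eqI simp: lookup_scaled lookup_add algebra_simps class_cring.cring_axioms)

lemma free_space_uminus:
  assumes "p \<in> carrier (free_space X)"
  shows "\<ominus>\<^bsub>free_space X\<^esub> p = - p"
proof -
  interpret Module.module class_ring "free_space X" by (rule free_space_module)
  show ?thesis
    using assms by (intro M.minus_equality) (auto simp: in_keys_iff)
qed

lemma free_space_diff_closed:
  "Poly_Mapping.keys p \<subseteq> X \<Longrightarrow> Poly_Mapping.keys q \<subseteq> X \<Longrightarrow> Poly_Mapping.keys (p - q) \<subseteq> X"
  for p q :: "'a \<Rightarrow>\<^sub>0 complex"
  using keys_diff[of p q] by blast

lemma linear_map_free_diff:
  assumes "complex_module W" "f \<in> linear_maps (free_space X) W"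
    and "Poly_Mapping.keys p \<subseteq> X" "Poly_Mapping.keys q \<subseteq> X"
  shows "f (p - q) = f p \<ominus>\<^bsub>W\<^esub> f q"
proof -
  have "f (p - q) = f (p \<oplus>\<^bsub>free_space X\<^esub> (\<ominus>\<^bsub>free_space X\<^esub> q))"
    using assms(4) by (simp add: free_space_uminus)
  also have "\<dots> = f p \<oplus>\<^bsub>W\<^esub> f (\<ominus>\<^bsub>free_space X\<^esub> q)"
    using assms(3,4) free_space_uminus[of q X]
    by (intro linear_map_add[OF assms(2)]) (simp_all add: in_keys_iff subset_iff)
  also have "f (\<ominus>\<^bsub>free_space X\<^esub> q) = \<ominus>\<^bsub>W\<^esub> f q"
    using assms by (intro linear_map_uminus[OF free_space_module]) simp_all
  finally show ?thesis by (simp add: a_minus_def)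
qed

text \<open>
  The linear extension of a map \<open>b\<close> on the basis. A sum over the support of \<open>p\<close> is awkward under
  addition, since the support of \<open>p + q\<close> may shrink by cancellation; the next lemma allows any finite
  set that contains the support, so that \<open>p\<close>, \<open>q\<close> and \<open>p + q\<close> can share one.
\<close>

definition free_extension ::
    "(complex, 'w) module \<Rightarrow> ('a \<Rightarrow> 'w) \<Rightarrow> ('a \<Rightarrow>\<^sub>0 complex) \<Rightarrow> 'w" where
  "free_extension W b p = (\<Oplus>\<^bsub>W\<^esub>x\<in>Poly_Mapping.keys p. Poly_Mapping.lookup p x \<odot>\<^bsub>W\<^esub> b x)"

lemma free_extension_superset:
  assumes "complex_module W" "finite S" "Poly_Mapping.keys p \<subseteq> S" "\<And>x. x \<in> S \<Longrightarrow> b x \<in> carrier W"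
  shows "free_extension W b p = (\<Oplus>\<^bsub>W\<^esub>x\<in>S. Poly_Mapping.lookup p x \<odot>\<^bsub>W\<^esub> b x)"
proof -
  interpret W: Module.module class_ring W by fact
  show ?thesis
    unfolding free_extension_def using assms(2-4)
    by (intro W.add.finprod_mono_neutral_cong_left)
      (auto simp: in_keys_iff W.smult_l_null[simplified])
qed

lemma free_extension_linear:
  assumes "complex_module W" "\<And>x. x \<in> X \<Longrightarrow> b x \<in> carrier W"
  shows "free_extension W b \<in> linear_maps (free_space X) W"
proof -
  interpret W: Module.module class_ring W by fact
  note W = assms(1)
  have closed: "a \<odot>\<^bsub>W\<^esub> b x \<in> carrier W" if "x \<in> X" for a x
    using assms(2)[OF that] by simp
  show ?thesis
  proof (rule linear_mapI)
    fix p assume "p \<in> carrier (free_space X)"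
    then show "free_extension W b p \<in> carrier W"
      unfolding free_extension_def by (intro W.finsum_closed) (auto intro: closed)
  next
    fix p q assume "p \<in> carrier (free_space X)" "q \<in> carrier (free_space X)"
    then have keys: "Poly_Mapping.keys p \<subseteq> X" "Poly_Mapping.keys q \<subseteq> X"
      by simp_all
    let ?S = "Poly_Mapping.keys p \<union> Poly_Mapping.keys q"
    have S: "finite ?S" "\<And>x. x \<in> ?S \<Longrightarrow> x \<in> X"
      using keys by auto
    have "free_extension W b (p + q)
        = (\<Oplus>\<^bsub>W\<^esub>x\<in>?S. Poly_Mapping.lookup (p + q) x \<odot>\<^bsub>W\<^esub> b x)"
      using S assms(2) Poly_Mapping.keys_add[of p q]
      by (intro free_extension_superset[OF W]) blast+
    also have "\<dots> = (\<Oplus>\<^bsub>W\<^esub>x\<in>?S. Poly_Mapping.lookup p x \<odot>\<^bsub>W\<^esub> b x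
        \<oplus>\<^bsub>W\<^esub> Poly_Mapping.lookup q x \<odot>\<^bsub>W\<^esub> b x)"
      using W.smult_l_distr[simplified] S(2)
      by (intro W.finsum_cong' refl) (simp_all add: Pi_def lookup_add closed assms(2))
    also have "\<dots> = (\<Oplus>\<^bsub>W\<^esub>x\<in>?S. Poly_Mapping.lookup p x \<odot>\<^bsub>W\<^esub> b x)
        \<oplus>\<^bsub>W\<^esub> (\<Oplus>\<^bsub>W\<^esub>x\<in>?S. Poly_Mapping.lookup q x \<odot>\<^bsub>W\<^esub> b x)"
      using S(2) by (intro W.finsum_addf) (auto intro: closed)
    also have "\<dots> = free_extension W b p \<oplus>\<^bsub>W\<^esub> free_extension W b q"
      using S assms(2) free_extension_superset[OF W S(1), of p b]
        free_extension_superset[OF W S(1), of q b] by simp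
    finally show "free_extension W b (p \<oplus>\<^bsub>free_space X\<^esub> q)
        = free_extension W b p \<oplus>\<^bsub>W\<^esub> free_extension W b q" by simp
  next
    fix c p assume "p \<in> carrier (free_space X)"
    then have keys: "\<And>x. x \<in> Poly_Mapping.keys p \<Longrightarrow> x \<in> X"
      by auto
    have "free_extension W b (Poly_Mapping.map ((*) c) p)
        = (\<Oplus>\<^bsub>W\<^esub>x\<in>Poly_Mapping.keys p. Poly_Mapping.lookup (Poly_Mapping.map ((*) c) p) x \<odot>\<^bsub>W\<^esub> b x)"
      using keys assms(2) by (intro free_extension_superset[OF W] keys_scaled) auto
    also have "\<dots> = (\<Oplus>\<^bsub>W\<^esub>x\<in>Poly_Mapping.keys p. c \<odot>\<^bsub>W\<^esub> (Poly_Mapping.lookup p x \<odot>\<^bsub>W\<^esub> b x))"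
      using keys W.smult_assoc1[simplified]
      by (intro W.finsum_cong' refl) (simp_all add: Pi_def lookup_scaled closed assms(2))
    also have "\<dots> = c \<odot>\<^bsub>W\<^esub> free_extension W b p"
      unfolding free_extension_def using keys
      by (intro W.finsum_smult_ldistr[symmetric]) (auto intro: closed)
    finally show "free_extension W b (c \<odot>\<^bsub>free_space X\<^esub> p) = c \<odot>\<^bsub>W\<^esub> free_extension W b p"
      by simp
  qed
qed

lemma free_extension_single:
  assumes "complex_module W" "b x \<in> carrier W"
  shows "free_extension W b (Poly_Mapping.single x c) = c \<odot>\<^bsub>W\<^esub> b x"
proof -
  interpret W: Module.module class_ring W by fact
  show ?thesis
    using assms(2) by (subst free_extension_superset[OF assms(1), of "{x}"])
      (simp_all add: W.finsum_insert)
qed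

text \<open>
  The unit vectors generate: removing one basis element at a time from the support reduces \<open>p\<close> to
  \<open>0\<close>, where all linear maps agree.
\<close>

lemma free_space_linear_ext:
  assumes "f \<in> linear_maps (free_space X) W" "g \<in> linear_maps (free_space X) W"
    and "complex_module W"
    and eq: "\<And>x. x \<in> X \<Longrightarrow> f (Poly_Mapping.single x 1) = g (Poly_Mapping.single x 1)"
    and "p \<in> carrier (free_space X)"
  shows "f p = g p"
proof -
  have "finite S \<Longrightarrow> S \<subseteq> X \<Longrightarrow> Poly_Mapping.keys p \<subseteq> S \<Longrightarrow> f p = g p" for S p
  proof (induction S arbitrary: p rule: finite_induct)
    case empty
    then have "p = \<zero>\<^bsub>free_space X\<^esub>" by simp
    then show ?case
      using linear_map_zero[OF free_space_module assms(3)] assms(1,2) by metis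
  next
    case (insert x S)
    \<comment> \<open>Split off the component of \<open>p\<close> at \<open>x\<close>.\<close>
    define c where "c = Poly_Mapping.lookup p x"
    define q where "q = p - Poly_Mapping.single x c"
    have q: "Poly_Mapping.keys q \<subseteq> S"
      using insert.prems by (auto simp: q_def c_def in_keys_iff lookup_minus lookup_single when_def
          split: if_splits)
    have p: "p = q \<oplus>\<^bsub>free_space X\<^esub> (c \<odot>\<^bsub>free_space X\<^esub> Poly_Mapping.single x 1)"
      by (simp add: q_def)
    have carr: "q \<in> carrier (free_space X)" "Poly_Mapping.single x 1 \<in> carrier (free_space X)"
      "c \<odot>\<^bsub>free_space X\<^esub> Poly_Mapping.single x 1 \<in> carrier (free_space X)"
      using q insert.prems by auto
    have "f q = g q"
      using insert q by auto
    then show ?case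
      unfolding p using insert.prems
      by (simp only: linear_map_add[OF assms(1) carr(1,3)] linear_map_add[OF assms(2) carr(1,3)]
          linear_map_smult[OF assms(1) carr(2)] linear_map_smult[OF assms(2) carr(2)]) (simp add: eq)
  qed
  from this[of "Poly_Mapping.keys p" p] show ?thesis using assms(5) by simp
qed

text \<open>
  This makes the linearity of \<open>free_map\<close> an instance of the linearity of linear extensions.
\<close>

lemma free_map_eq_free_extension:
  assumes "h \<in> X \<rightarrow> Y" "p \<in> carrier (free_space X)"
  shows "free_map h p = free_extension (free_space Y) (\<lambda>x. Poly_Mapping.single (h x) 1) p"
proof -
  interpret Y: Module.module class_ring "free_space Y" by (rule free_space_module)
  have "finite S \<Longrightarrow> S \<subseteq> X \<Longrightarrow> (\<Sum>x\<in>S. Poly_Mapping.single (h x) (c x))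
    = (\<Oplus>\<^bsub>free_space Y\<^esub>x\<in>S. c x \<odot>\<^bsub>free_space Y\<^esub> Poly_Mapping.single (h x) 1)" for S c
  proof (induction S rule: finite_induct)
    case empty
    show ?case by simp
  next
    case (insert x S)
    then have "h x \<in> Y" "\<And>z. z \<in> S \<Longrightarrow> h z \<in> Y"
      using assms(1) by auto
    then show ?case
      using insert by (subst Y.finsum_insert) (auto split: if_splits)
  qed
  from this[of "Poly_Mapping.keys p"] show ?thesis
    using assms(2) by (simp add: free_map_def free_extension_def)
qed

lemma free_map_linear:
  assumes "h \<in> X \<rightarrow> Y"
  shows "free_map h \<in> linear_maps (free_space X) (free_space Y)"
proof (rule linear_map_cong[OF free_space_module])
  show "free_extension (free_space Y) (\<lambda>x. Poly_Mapping.single (h x) 1)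
      \<in> linear_maps (free_space X) (free_space Y)"
    using assms by (intro free_extension_linear free_space_module) auto
qed (simp add: free_map_eq_free_extension[OF assms])

lemma free_map_single: "free_map h (Poly_Mapping.single x c) = Poly_Mapping.single (h x) c"
  by (simp add: free_map_def)

section \<open>Quotient spaces\<close>

lemma submodule_abelian_subgroup:
  assumes "complex_module V" "LinearCombinations.submodule class_ring N V"
  shows "abelian_subgroup N V"
proof (rule abelian_subgroupI3)
  interpret V: Module.module class_ring V by fact
  interpret N: LinearCombinations.submodule class_ring N V by fact
  show "abelian_group V" ..
  show "additive_subgroup N V"
  proof (rule additive_subgroupI, rule V.add.subgroupI)
    show "\<ominus>\<^bsub>V\<^esub> v \<in> N" if "v \<in> N" for v
    proof -
      have "v \<in> carrier V"
        using that N.subset by blast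
      then have "\<ominus>\<^bsub>V\<^esub> v = (- 1) \<odot>\<^bsub>V\<^esub> v"
        using V.smult_minus_1[of v] by (simp add: class_ring_simps)
      then show ?thesis
        using N.smult_closed[of "- 1" v] that by simp
    qed
    show "N \<noteq> {}"
      using N.zero_closed by blast
  qed (use N.subset in auto)
qed

lemma quotient_space_simps [simp]:
  "\<zero>\<^bsub>quotient_space V N\<^esub> = N"
  "A \<oplus>\<^bsub>quotient_space V N\<^esub> B = A <+>\<^bsub>V\<^esub> B"
  by (simp_all add: quotient_space_def)

lemma quotient_space_carrier: "carrier (quotient_space V N) = (\<lambda>v. N +>\<^bsub>V\<^esub> v) ` carrier V"
  by (auto simp: quotient_space_def A_RCOSETS_def')

locale quotient =
  fixes V :: "(complex, 'v) module" and N :: "'v set"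
  assumes V: "complex_module V" and N: "LinearCombinations.submodule class_ring N V"
begin

interpretation V: Module.module class_ring V by (rule V)
interpretation N: LinearCombinations.submodule class_ring N V by (rule N)
interpretation N: abelian_subgroup N V by (rule submodule_abelian_subgroup[OF V N])

text \<open>
  Two elements of a coset differ by an element of \<open>N\<close>, on which \<open>f\<close> vanishes. This is what makes constructions by choosing
  a representative, or by a union over all of them, well defined.
\<close>

lemma constant_on_coset:
  assumes "complex_module W" "f \<in> linear_maps V W"
    and ker: "\<And>n. n \<in> N \<Longrightarrow> f n = \<zero>\<^bsub>W\<^esub>"
    and v: "v \<in> carrier V" and u: "u \<in> N +>\<^bsub>V\<^esub> v"
  shows "f u = f v"
proof -
  interpret W: Module.module class_ring W by fact
  obtain n where n: "n \<in> N" "u = n \<oplus>\<^bsub>V\<^esub> v"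
    using u by (auto simp: a_r_coset_def')
  then have "f u = f n \<oplus>\<^bsub>W\<^esub> f v"
    using v N.subset by (auto intro: linear_map_add[OF assms(2)])
  then show ?thesis
    using n v ker linear_map_closed[OF assms(2)] by simp
qed

lemma coset_eq_if_diff:
  assumes "u \<in> carrier V" "v \<in> carrier V" "u \<ominus>\<^bsub>V\<^esub> v \<in> N"
  shows "N +>\<^bsub>V\<^esub> u = N +>\<^bsub>V\<^esub> v"
  using N.a_rcos_module_rev[of v u] N.a_repr_independence'[of u v] assms
  by (simp add: a_minus_def)

lemma coset_smult:
  assumes v: "v \<in> carrier V"
  shows "c \<odot>\<^bsub>quotient_space V N\<^esub> (N +>\<^bsub>V\<^esub> v) = N +>\<^bsub>V\<^esub> (c \<odot>\<^bsub>V\<^esub> v)"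
proof -
  have "N +>\<^bsub>V\<^esub> (c \<odot>\<^bsub>V\<^esub> u) = N +>\<^bsub>V\<^esub> (c \<odot>\<^bsub>V\<^esub> v)" if u: "u \<in> N +>\<^bsub>V\<^esub> v" for u
  proof -
    have u': "u \<in> carrier V" by (rule N.a_elemrcos_carrier[OF v u])
    have "u \<ominus>\<^bsub>V\<^esub> v \<in> N"
      using N.a_rcos_module_imp[OF v u] by (simp add: a_minus_def)
    then have "c \<odot>\<^bsub>V\<^esub> (u \<ominus>\<^bsub>V\<^esub> v) \<in> N" by (intro N.smult_closed) simp_all
    moreover have "c \<odot>\<^bsub>V\<^esub> (u \<ominus>\<^bsub>V\<^esub> v) = c \<odot>\<^bsub>V\<^esub> u \<ominus>\<^bsub>V\<^esub> c \<odot>\<^bsub>V\<^esub> v"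
      using u' v by (simp add: a_minus_def V.smult_r_distr V.smult_r_minus)
    ultimately show ?thesis
      using u' v by (intro coset_eq_if_diff) simp_all
  qed
  moreover have "N +>\<^bsub>V\<^esub> v \<noteq> {}"
    using N.a_rcos_self[OF v] by blast
  ultimately have "(\<Union>u\<in>N +>\<^bsub>V\<^esub> v. N +>\<^bsub>V\<^esub> (c \<odot>\<^bsub>V\<^esub> u)) = N +>\<^bsub>V\<^esub> (c \<odot>\<^bsub>V\<^esub> v)"
    by (intro SUP_eq_const)
  then show ?thesis by (simp add: quotient_space_def)
qed

lemma quotient_module: "complex_module (quotient_space V N)"
  by (rule complex_module_surj_image[OF V, where f = "\<lambda>v. N +>\<^bsub>V\<^esub> v"])
    (simp_all add: quotient_space_carrier N.a_rcos_sum coset_smult N.a_rcos_const)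

lemma coset_linear: "(\<lambda>v. N +>\<^bsub>V\<^esub> v) \<in> linear_maps V (quotient_space V N)"
  by (rule linear_mapI) (simp_all add: quotient_space_carrier N.a_rcos_sum coset_smult)

lemma coset_of_kernel: "n \<in> N \<Longrightarrow> N +>\<^bsub>V\<^esub> n = \<zero>\<^bsub>quotient_space V N\<^esub>"
  by (simp add: N.a_rcos_const)

text \<open>
  Every coset is the class of some \<open>v\<close>, so a map out of the quotient that is given on classes by a
  linear map \<open>f\<close> inherits linearity from \<open>f\<close>.
\<close>

lemma quotient_linear:
  assumes "f \<in> linear_maps V W" and F: "\<And>v. v \<in> carrier V \<Longrightarrow> F (N +>\<^bsub>V\<^esub> v) = f v"
  shows "F \<in> linear_maps (quotient_space V N) W"
proof (rule linear_mapI)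
  fix A B assume "A \<in> carrier (quotient_space V N)" "B \<in> carrier (quotient_space V N)"
  then obtain u v where uv: "u \<in> carrier V" "v \<in> carrier V"
    and AB: "A = N +>\<^bsub>V\<^esub> u" "B = N +>\<^bsub>V\<^esub> v"
    by (auto simp: quotient_space_carrier)
  show "F A \<in> carrier W"
    using uv linear_map_closed[OF assms(1)] by (simp add: AB F)
  show "F (A \<oplus>\<^bsub>quotient_space V N\<^esub> B) = F A \<oplus>\<^bsub>W\<^esub> F B"
    using uv linear_map_add[OF assms(1)] by (simp add: AB F N.a_rcos_sum)
  show "F (c \<odot>\<^bsub>quotient_space V N\<^esub> A) = c \<odot>\<^bsub>W\<^esub> F A" for c
    using uv linear_map_smult[OF assms(1)] by (simp add: AB F coset_smult)
qed

lemma some_coset_representative: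
  assumes "complex_module W" "f \<in> linear_maps V W" "\<And>n. n \<in> N \<Longrightarrow> f n = \<zero>\<^bsub>W\<^esub>"
    and "v \<in> carrier V"
  shows "f (SOME u. u \<in> N +>\<^bsub>V\<^esub> v) = f v"
proof (rule constant_on_coset[OF assms])
  show "(SOME u. u \<in> N +>\<^bsub>V\<^esub> v) \<in> N +>\<^bsub>V\<^esub> v"
    using N.a_rcos_self[OF assms(4)] by (metis someI)
qed

lemma union_over_coset:
  assumes "complex_module W" "f \<in> linear_maps V W" "\<And>n. n \<in> N \<Longrightarrow> f n = \<zero>\<^bsub>W\<^esub>"
    and "v \<in> carrier V"
  shows "(\<Union>u\<in>N +>\<^bsub>V\<^esub> v. f u) = f v"
  by (rule SUP_eq_const) (use constant_on_coset[OF assms] N.a_rcos_self[OF assms(4)] in blast)+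

end

section \<open>Tensor products\<close>

definition bilinear ::
    "(complex, 'v) module \<Rightarrow> (complex, 'w) module \<Rightarrow> (complex, 'x) module \<Rightarrow>
      ('v \<Rightarrow> 'w \<Rightarrow> 'x) \<Rightarrow> bool" where
  "bilinear V W X B \<longleftrightarrow>
    (\<forall>w\<in>carrier W. (\<lambda>v. B v w) \<in> linear_maps V X) \<and> (\<forall>v\<in>carrier V. B v \<in> linear_maps W X)"

lemma bilinearD:
  assumes "bilinear V W X B"
  shows "w \<in> carrier W \<Longrightarrow> (\<lambda>v. B v w) \<in> linear_maps V X"
    and "v \<in> carrier V \<Longrightarrow> B v \<in> linear_maps W X"
  using assms by (simp_all add: bilinear_def)

lemma bilinear_closed:
  assumes "bilinear V W X B" "v \<in> carrier V" "w \<in> carrier W"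
  shows "B v w \<in> carrier X"
  using assms by (meson bilinearD(2) linear_map_closed)

lemma bilinear_compose:
  assumes B: "bilinear V W X B" and a: "a \<in> linear_maps V' V" and b: "b \<in> linear_maps W' W"
  shows "bilinear V' W' X (\<lambda>v w. B (a v) (b w))"
  unfolding bilinear_def
  using linear_map_compose[OF a bilinearD(1)[OF B]] linear_map_compose[OF b bilinearD(2)[OF B]]
    linear_map_closed[OF a] linear_map_closed[OF b] by blast

definition pure_tensor ::
    "(complex, 'v) module \<Rightarrow> (complex, 'w) module \<Rightarrow> 'v \<Rightarrow> 'w \<Rightarrow> ('v \<times> 'w \<Rightarrow>\<^sub>0 complex) set" where
  "pure_tensor V W v w =
    tensor_kernel V W +>\<^bsub>free_space (carrier V \<times> carrier W)\<^esub> Poly_Mapping.single (v, w) 1"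

text \<open>
  The linear map out of the tensor product that a bilinear map \<open>B\<close> induces: extend \<open>B\<close> linearly to
  the free space and evaluate at a representative of the class.
\<close>

definition tensor_lift ::
    "(complex, 'x) module \<Rightarrow> ('v \<Rightarrow> 'w \<Rightarrow> 'x) \<Rightarrow> ('v \<times> 'w \<Rightarrow>\<^sub>0 complex) set \<Rightarrow> 'x" where
  "tensor_lift X B A = free_extension X (\<lambda>(v, w). B v w) (SOME p. p \<in> A)"

lemma (in Module.module) minus_minus_eq_zero_iff:
  assumes "a \<in> carrier M" "b \<in> carrier M" "c \<in> carrier M"
  shows "a \<ominus>\<^bsub>M\<^esub> b \<ominus>\<^bsub>M\<^esub> c = \<zero>\<^bsub>M\<^esub> \<longleftrightarrow> a = b \<oplus>\<^bsub>M\<^esub> c"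
proof -
  have "a \<ominus>\<^bsub>M\<^esub> b \<ominus>\<^bsub>M\<^esub> c = a \<ominus>\<^bsub>M\<^esub> (b \<oplus>\<^bsub>M\<^esub> c)"
    using assms by (simp add: a_minus_def M.minus_add M.a_ac)
  then show ?thesis
    using assms by simp
qed

locale tensor_product =
  fixes V :: "(complex, 'v) module" and W :: "(complex, 'w) module"
  assumes V: "complex_module V" and W: "complex_module W"
begin

abbreviation F where "F \<equiv> free_space (carrier V \<times> carrier W)"

abbreviation e where "e v w \<equiv> Poly_Mapping.single (v, w) (1 :: complex)"

interpretation V: Module.module class_ring V by (rule V)
interpretation W: Module.module class_ring W by (rule W)
interpretation F: Module.module class_ring F by (rule free_space_module)

lemma smult_closed:
  "v \<in> carrier V \<Longrightarrow> c \<odot>\<^bsub>V\<^esub> v \<in> carrier V" "w \<in> carrier W \<Longrightarrow> c \<odot>\<^bsub>W\<^esub> w \<in> carrier W"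
  by simp_all

lemma single_closed:
  "v \<in> carrier V \<Longrightarrow> w \<in> carrier W \<Longrightarrow>
    Poly_Mapping.keys (Poly_Mapping.single (v, w) (c :: complex)) \<subseteq> carrier V \<times> carrier W"
  by simp

lemma bilinear_relations_closed: "bilinear_relations V W \<subseteq> carrier F"
  unfolding bilinear_relations_def Let_def
  by (intro Un_least subsetI; elim CollectE exE conjE; hypsubst;
      simp only: free_space_simps mem_Collect_eq;
      intro free_space_diff_closed single_closed V.a_closed W.a_closed smult_closed; assumption)

lemma tensor_kernel_submodule: "LinearCombinations.submodule class_ring (tensor_kernel V W) F"
  unfolding tensor_kernel_def by (rule F.span_is_submodule[OF bilinear_relations_closed])

lemma bilinear_relations_in_kernel: "bilinear_relations V W \<subseteq> tensor_kernel V W"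
  unfolding tensor_kernel_def by (rule F.in_own_span[OF bilinear_relations_closed])

sublocale tensor: quotient F "tensor_kernel V W"
  by (rule quotient.intro[OF free_space_module tensor_kernel_submodule])

abbreviation T where "T \<equiv> tensor_space V W"

lemma tensor_module: "complex_module T"
  unfolding tensor_space_def by (rule tensor.quotient_module)

interpretation T: Module.module class_ring T by (rule tensor_module)

abbreviation cls where "cls p \<equiv> tensor_kernel V W +>\<^bsub>F\<^esub> p"

lemma cls_linear: "cls \<in> linear_maps F T"
  unfolding tensor_space_def by (rule tensor.coset_linear)

lemma pure_tensor_closed:
  "v \<in> carrier V \<Longrightarrow> w \<in> carrier W \<Longrightarrow> pure_tensor V W v w \<in> carrier T"
  unfolding pure_tensor_def by (rule linear_map_closed[OF cls_linear]) simp

lemma linear_map_single: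
  assumes "f \<in> linear_maps F X" "v \<in> carrier V" "w \<in> carrier W"
  shows "f (Poly_Mapping.single (v, w) c) = c \<odot>\<^bsub>X\<^esub> f (e v w)"
  using linear_map_smult[OF assms(1), of "e v w" c] assms(2,3) by simp

lemma linear_map_kills_kernel_iff:
  assumes X: "complex_module X" and f: "f \<in> linear_maps F X"
  shows "(\<forall>p\<in>tensor_kernel V W. f p = \<zero>\<^bsub>X\<^esub>) \<longleftrightarrow> (\<forall>p\<in>bilinear_relations V W. f p = \<zero>\<^bsub>X\<^esub>)"
proof
  assume *: "\<forall>p\<in>bilinear_relations V W. f p = \<zero>\<^bsub>X\<^esub>"
  interpret f: mod_hom class_ring F X f
    using X f free_space_module by (simp add: mod_hom_def mod_hom_axioms_def)
  have "bilinear_relations V W \<subseteq> f.ker"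
    using * bilinear_relations_closed by (auto simp: f.ker_def)
  then have "tensor_kernel V W \<subseteq> f.ker"
    unfolding tensor_kernel_def by (rule F.span_is_subset[OF _ f.ker_is_submodule])
  then show "\<forall>p\<in>tensor_kernel V W. f p = \<zero>\<^bsub>X\<^esub>"
    by (auto simp: f.ker_def)
qed (use bilinear_relations_in_kernel in blast)

text \<open>
  The generators of the kernel are the bilinearity equations with both sides moved to the left, so a
  linear map vanishes on all of them exactly when its values on the basis depend bilinearly on the
  index. Applied to the projection to the quotient, this shows that \<open>\<otimes>\<close> is bilinear; applied to the
  linear extension of a bilinear map, it shows that this extension factors through the quotient.
\<close>

lemma kills_relations_iff_bilinear:
  assumes X: "complex_module X" and f: "f \<in> linear_maps F X"
  shows "(\<forall>p\<in>bilinear_relations V W. f p = \<zero>\<^bsub>X\<^esub>) \<longleftrightarrow> bilinear V W X (\<lambda>v w. f (e v w))"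
proof -
  interpret X: Module.module class_ring X by (rule X)
  have closed: "f (e v w) \<in> carrier X" if "v \<in> carrier V" "w \<in> carrier W" for v w
    using that by (intro linear_map_closed[OF f]) simp
  have sclosed: "c \<odot>\<^bsub>X\<^esub> x \<in> carrier X" if "x \<in> carrier X" for c x
    using that by simp
  have diff: "f (p - q) = f p \<ominus>\<^bsub>X\<^esub> f q"
    if "Poly_Mapping.keys p \<subseteq> carrier V \<times> carrier W" "Poly_Mapping.keys q \<subseteq> carrier V \<times> carrier W" for p q
    by (rule linear_map_free_diff[OF X f that])
  have add_rel: "f (e u x - e v y - e w z) = \<zero>\<^bsub>X\<^esub> \<longleftrightarrow> f (e u x) = f (e v y) \<oplus>\<^bsub>X\<^esub> f (e w z)"
    if "u \<in> carrier V" "v \<in> carrier V" "w \<in> carrier V" "x \<in> carrier W" "y \<in> carrier W" "z \<in> carrier W"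
    for u v w x y z
  proof -
    have "f (e u x - e v y - e w z) = f (e u x) \<ominus>\<^bsub>X\<^esub> f (e v y) \<ominus>\<^bsub>X\<^esub> f (e w z)"
      using that by (simp add: diff free_space_diff_closed)
    then show ?thesis
      using X.minus_minus_eq_zero_iff[OF closed[OF that(1,4)] closed[OF that(2,5)] closed[OF that(3,6)]]
      by (simp only:)
  qed
  have smult_rel: "f (e u x - Poly_Mapping.single (v, y) c) = \<zero>\<^bsub>X\<^esub> \<longleftrightarrow> f (e u x) = c \<odot>\<^bsub>X\<^esub> f (e v y)"
    if "u \<in> carrier V" "v \<in> carrier V" "x \<in> carrier W" "y \<in> carrier W"
    for u v x y c
    using that by (subst diff) (simp_all add: linear_map_single[OF f that(2,4), of c] closed sclosed)
  show ?thesis (is "?L \<longleftrightarrow> ?R")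
  proof
    assume L: ?L
    then have
      "\<forall>v v' w. v \<in> carrier V \<and> v' \<in> carrier V \<and> w \<in> carrier W \<longrightarrow>
        f (e (v \<oplus>\<^bsub>V\<^esub> v') w - e v w - e v' w) = \<zero>\<^bsub>X\<^esub>"
      "\<forall>v w w'. v \<in> carrier V \<and> w \<in> carrier W \<and> w' \<in> carrier W \<longrightarrow>
        f (e v (w \<oplus>\<^bsub>W\<^esub> w') - e v w - e v w') = \<zero>\<^bsub>X\<^esub>"
      "\<forall>c v w. v \<in> carrier V \<and> w \<in> carrier W \<longrightarrow>
        f (e (c \<odot>\<^bsub>V\<^esub> v) w - Poly_Mapping.single (v, w) c) = \<zero>\<^bsub>X\<^esub>"
      "\<forall>c v w. v \<in> carrier V \<and> w \<in> carrier W \<longrightarrow>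
        f (e v (c \<odot>\<^bsub>W\<^esub> w) - Poly_Mapping.single (v, w) c) = \<zero>\<^bsub>X\<^esub>"
      unfolding bilinear_relations_def Let_def by blast+
    then show ?R
      unfolding bilinear_def by (intro conjI ballI linear_mapI)
        (simp_all add: add_rel smult_rel smult_closed closed)
  next
    assume R: ?R
    note lin = linear_map_add[OF bilinearD(1)[OF R]] linear_map_add[OF bilinearD(2)[OF R]]
      linear_map_smult[OF bilinearD(1)[OF R]] linear_map_smult[OF bilinearD(2)[OF R]]
    show ?L
      unfolding bilinear_relations_def Let_def
      by (auto simp: add_rel smult_rel smult_closed closed lin)
  qed
qed

lemma pure_tensor_bilinear: "bilinear V W T (pure_tensor V W)"
  using kills_relations_iff_bilinear[OF tensor_module cls_linear]
    linear_map_kills_kernel_iff[OF tensor_module cls_linear] tensor.coset_of_kernel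
  unfolding pure_tensor_def tensor_space_def by blast

lemma linear_map_kills_kernel:
  assumes "complex_module X" "f \<in> linear_maps F X" "bilinear V W X (\<lambda>v w. f (e v w))"
    and "p \<in> tensor_kernel V W"
  shows "f p = \<zero>\<^bsub>X\<^esub>"
  using assms kills_relations_iff_bilinear linear_map_kills_kernel_iff by blast

text \<open>
  The universal property of the tensor product; uniqueness follows in \<open>tensor_linear_ext\<close>.
\<close>

lemma
  assumes X: "complex_module X" and B: "bilinear V W X B"
  shows tensor_lift_linear: "tensor_lift X B \<in> linear_maps T X"
    and tensor_lift_pure:
      "\<And>v w. v \<in> carrier V \<Longrightarrow> w \<in> carrier W \<Longrightarrow> tensor_lift X B (pure_tensor V W v w) = B v w"
proof -
  interpret X: Module.module class_ring X by (rule X)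
  let ?f = "free_extension X (\<lambda>(v, w). B v w)"
  have f: "?f \<in> linear_maps F X"
    using bilinear_closed[OF B] by (intro free_extension_linear X) auto
  have single: "?f (e v w) = B v w" if "v \<in> carrier V" "w \<in> carrier W" for v w
    using that bilinear_closed[OF B that] by (subst free_extension_single[OF X])
      (simp_all add: X.smult_one[simplified])
  have bil: "bilinear V W X (\<lambda>v w. ?f (e v w))"
    unfolding bilinear_def
  proof (intro conjI ballI)
    show "(\<lambda>v. ?f (e v w)) \<in> linear_maps V X" if "w \<in> carrier W" for w
      by (rule linear_map_cong[OF V bilinearD(1)[OF B that]]) (simp only: single that)
    show "(\<lambda>w. ?f (e v w)) \<in> linear_maps W X" if "v \<in> carrier V" for v
      by (rule linear_map_cong[OF W bilinearD(2)[OF B that]]) (simp only: single that)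
  qed
  have lift: "tensor_lift X B (cls p) = ?f p" if "p \<in> carrier F" for p
    unfolding tensor_lift_def
    by (rule tensor.some_coset_representative[OF X f linear_map_kills_kernel[OF X f bil] that])
  show "tensor_lift X B \<in> linear_maps T X"
    unfolding tensor_space_def by (rule tensor.quotient_linear[OF f lift])
  show "tensor_lift X B (pure_tensor V W v w) = B v w" if "v \<in> carrier V" "w \<in> carrier W" for v w
    using that by (simp add: pure_tensor_def lift single)
qed

text \<open>
  Pure tensors are the classes of the unit vectors of the free space, so they generate. All later
  identities between linear maps on tensor products are checked on pure tensors by this lemma.
\<close>

lemma tensor_linear_ext:
  assumes "complex_module X" "f \<in> linear_maps T X" "g \<in> linear_maps T X"
    and "\<And>v w. v \<in> carrier V \<Longrightarrow> w \<in> carrier W \<Longrightarrow> f (pure_tensor V W v w) = g (pure_tensor V W v w)"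
    and "t \<in> carrier T"
  shows "f t = g t"
proof -
  obtain p where p: "p \<in> carrier F" "t = cls p"
    using assms(5) by (auto simp: tensor_space_def quotient_space_carrier)
  have "f (cls p) = g (cls p)"
    by (rule free_space_linear_ext[OF linear_map_compose[OF cls_linear assms(2)]
          linear_map_compose[OF cls_linear assms(3)] assms(1) _ p(1)])
      (use assms(4) in \<open>auto simp: pure_tensor_def\<close>)
  then show ?thesis by (simp add: p)
qed

text \<open>
  The map \<open>p \<mapsto> [free_map (map_prod a b) p]\<close> sends the unit vector at \<open>(v, w)\<close> to \<open>a v \<otimes> b w\<close>, which is
  bilinear in \<open>(v, w)\<close>. Hence it is constant on cosets, and the union in the definition of
  \<open>tensor_map\<close> has a single distinct member.
\<close>

lemma
  assumes a: "a \<in> linear_maps V V" and b: "b \<in> linear_maps W W"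
  shows tensor_map_linear: "tensor_map V W a b \<in> linear_maps T T"
    and tensor_map_pure: "\<And>v w. v \<in> carrier V \<Longrightarrow> w \<in> carrier W \<Longrightarrow>
      tensor_map V W a b (pure_tensor V W v w) = pure_tensor V W (a v) (b w)"
proof -
  let ?f = "\<lambda>p. cls (free_map (map_prod a b) p)"
  have f: "?f \<in> linear_maps F T"
    using linear_map_closed[OF a] linear_map_closed[OF b]
    by (intro linear_map_compose[OF _ cls_linear] free_map_linear) auto
  have single: "?f (e v w) = pure_tensor V W (a v) (b w)" for v w
    by (simp add: free_map_single pure_tensor_def)
  have bil: "bilinear V W T (\<lambda>v w. ?f (e v w))"
    unfolding single by (rule bilinear_compose[OF pure_tensor_bilinear a b])
  have map: "tensor_map V W a b (cls p) = ?f p" if "p \<in> carrier F" for p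
    using linear_map_closed[OF cls_linear that]
      tensor.union_over_coset[OF tensor_module f linear_map_kills_kernel[OF tensor_module f bil] that]
    by (simp add: tensor_map_def)
  have "tensor_map V W a b \<in> linear_maps (quotient_space F (tensor_kernel V W)) T"
    by (rule tensor.quotient_linear[OF f map])
  then show "tensor_map V W a b \<in> linear_maps T T"
    by (simp add: tensor_space_def)
  show "tensor_map V W a b (pure_tensor V W v w) = pure_tensor V W (a v) (b w)"
    if "v \<in> carrier V" "w \<in> carrier W" for v w
    using that map[of "e v w"] single[of v w] by (simp add: pure_tensor_def)
qed

end

section \<open>Linear actions and induced spaces\<close>

text \<open>
  The algebraic content of a representation, with the laws stated pointwise. In
  \<open>linear_representation\<close> they are hidden in the product of the group \<open>GL\<close>, which composes functions
  restricted to the carrier.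
\<close>

locale linear_action =
  fixes G :: "('g, 'm) monoid_scheme" and \<rho> :: "('g, 'v) rep"
  assumes space: "complex_module (rep_space \<rho>)"
    and act_linear: "\<And>g. g \<in> carrier G \<Longrightarrow> rep_act \<rho> g \<in> linear_maps (rep_space \<rho>) (rep_space \<rho>)"
    and act_mult: "\<And>g h v. g \<in> carrier G \<Longrightarrow> h \<in> carrier G \<Longrightarrow> v \<in> carrier (rep_space \<rho>) \<Longrightarrow>
      rep_act \<rho> (g \<otimes>\<^bsub>G\<^esub> h) v = rep_act \<rho> g (rep_act \<rho> h v)"
    and act_one: "\<And>v. v \<in> carrier (rep_space \<rho>) \<Longrightarrow> rep_act \<rho> \<one>\<^bsub>G\<^esub> v = v"

text \<open>
  A homomorphism preserves products by definition, but that \<open>\<one>\<close> acts as the identity needs an argument: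
  its action is idempotent, and injective because it lies in \<open>GL\<close>.
\<close>

lemma linear_representation_action:
  assumes "linear_representation G \<rho>"
  shows "linear_action G \<rho>"
proof -
  interpret linear_representation G \<rho> by fact
  let ?V = "rep_space \<rho>"
  have bij: "rep_act \<rho> g \<in> Bij (carrier ?V)" and lin: "rep_act \<rho> g \<in> linear_maps ?V ?V"
    if "g \<in> carrier G" for g
    using hom_in_carrier[OF act_hom that] by (simp_all add: GL_def)
  have mult: "rep_act \<rho> (g \<otimes>\<^bsub>G\<^esub> h) v = rep_act \<rho> g (rep_act \<rho> h v)"
    if "g \<in> carrier G" "h \<in> carrier G" "v \<in> carrier ?V" for g h v
    using hom_mult[OF act_hom that(1,2)] bij that
    by (simp add: GL_def BijGroup_def compose_def)
  show ?thesis
  proof (rule linear_action.intro)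
    show "complex_module ?V" by (rule V.module_axioms)
    fix v assume v: "v \<in> carrier ?V"
    have "inj_on (rep_act \<rho> \<one>\<^bsub>G\<^esub>) (carrier ?V)"
      using bij[OF one_closed] by (simp add: Bij_def bij_betw_def)
    moreover have "rep_act \<rho> \<one>\<^bsub>G\<^esub> (rep_act \<rho> \<one>\<^bsub>G\<^esub> v) = rep_act \<rho> \<one>\<^bsub>G\<^esub> v"
      using mult[OF one_closed one_closed v] by simp
    ultimately show "rep_act \<rho> \<one>\<^bsub>G\<^esub> v = v"
      using v linear_map_closed[OF lin[OF one_closed] v] by (auto dest: inj_onD)
  qed (use lin mult in auto)
qed

lemma linear_map_const_zero:
  assumes "complex_module W"
  shows "(\<lambda>_. \<zero>\<^bsub>W\<^esub>) \<in> linear_maps V W"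
proof -
  interpret W: Module.module class_ring W by fact
  show ?thesis by (intro linear_mapI) simp_all
qed

lemma induced_space_simps [simp]:
  "f \<in> carrier (induced_space G H \<pi>) \<longleftrightarrow> f \<in> carrier G \<rightarrow>\<^sub>E carrier (rep_space \<pi>) \<and>
    (\<forall>h\<in>H. \<forall>x\<in>carrier G. f (h \<otimes>\<^bsub>G\<^esub> x) = rep_act \<pi> h (f x))"
  "\<zero>\<^bsub>induced_space G H \<pi>\<^esub> = (\<lambda>x\<in>carrier G. \<zero>\<^bsub>rep_space \<pi>\<^esub>)"
  "f \<oplus>\<^bsub>induced_space G H \<pi>\<^esub> f' = (\<lambda>x\<in>carrier G. f x \<oplus>\<^bsub>rep_space \<pi>\<^esub> f' x)"
  "c \<odot>\<^bsub>induced_space G H \<pi>\<^esub> f = (\<lambda>x\<in>carrier G. c \<odot>\<^bsub>rep_space \<pi>\<^esub> f x)"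
  by (simp_all add: induced_space_def)

lemma induced_space_eqI:
  assumes "f \<in> carrier (induced_space G H \<pi>)" "f' \<in> carrier (induced_space G H \<pi>)"
    and "\<And>x. x \<in> carrier G \<Longrightarrow> f x = f' x"
  shows "f = f'"
  using assms by (auto intro: PiE_ext)

text \<open>
  Linearity of each \<open>\<pi> h\<close> is what makes the equivariant functions closed under the pointwise operations.
\<close>

locale induction = group G + H: subgroup H G
  for G :: "('g, 'm) monoid_scheme" (structure) and H :: "'g set" +
  fixes \<pi> :: "('g, 'w) rep"
  assumes W: "complex_module (rep_space \<pi>)"
    and act: "\<And>h. h \<in> H \<Longrightarrow> rep_act \<pi> h \<in> linear_maps (rep_space \<pi>) (rep_space \<pi>)"
begin

interpretation W: Module.module class_ring "rep_space \<pi>" by (rule W)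

abbreviation Ind where "Ind \<equiv> induced_space G H \<pi>"

lemma value_closed: "f \<in> carrier Ind \<Longrightarrow> x \<in> carrier G \<Longrightarrow> f x \<in> carrier (rep_space \<pi>)"
  by auto

lemma equivariant:
  "f \<in> carrier Ind \<Longrightarrow> h \<in> H \<Longrightarrow> x \<in> carrier G \<Longrightarrow> f (h \<otimes> x) = rep_act \<pi> h (f x)"
  by simp

lemma restrict_in_inducedI:
  assumes "\<And>x. x \<in> carrier G \<Longrightarrow> f x \<in> carrier (rep_space \<pi>)"
    and "\<And>h x. h \<in> H \<Longrightarrow> x \<in> carrier G \<Longrightarrow> f (h \<otimes> x) = rep_act \<pi> h (f x)"
  shows "(\<lambda>x\<in>carrier G. f x) \<in> carrier Ind"
  using assms H.subset by (auto simp: subset_iff)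

lemma zero_closed: "\<zero>\<^bsub>Ind\<^esub> \<in> carrier Ind"
  unfolding induced_space_simps(2)
  by (rule restrict_in_inducedI) (simp_all add: linear_map_zero[OF W W act])

lemma add_closed: "f \<in> carrier Ind \<Longrightarrow> f' \<in> carrier Ind \<Longrightarrow> f \<oplus>\<^bsub>Ind\<^esub> f' \<in> carrier Ind"
  unfolding induced_space_simps(3)
  by (rule restrict_in_inducedI)
    (simp_all add: value_closed equivariant linear_map_add[OF act] del: induced_space_simps)

lemma smult_closed: "f \<in> carrier Ind \<Longrightarrow> c \<odot>\<^bsub>Ind\<^esub> f \<in> carrier Ind"
  unfolding induced_space_simps(4)
  by (rule restrict_in_inducedI)
    (simp_all add: value_closed equivariant linear_map_smult[OF act] del: induced_space_simps)

lemma induced_module: "complex_module Ind"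
proof (rule moduleI)
  note [simp del] = induced_space_simps(1)
  note closed = zero_closed add_closed smult_closed
  show "abelian_group Ind"
  proof (rule abelian_groupI)
    fix f g k assume fgk: "f \<in> carrier Ind" "g \<in> carrier Ind" "k \<in> carrier Ind"
    show "f \<oplus>\<^bsub>Ind\<^esub> g \<oplus>\<^bsub>Ind\<^esub> k = f \<oplus>\<^bsub>Ind\<^esub> (g \<oplus>\<^bsub>Ind\<^esub> k)"
      using fgk by (intro induced_space_eqI[of _ G H \<pi>] add_closed) (simp_all add: value_closed W.a_assoc)
    show "f \<oplus>\<^bsub>Ind\<^esub> g = g \<oplus>\<^bsub>Ind\<^esub> f"
      using fgk by (intro induced_space_eqI[of _ G H \<pi>] add_closed) (simp_all add: value_closed W.a_comm)
  next
    fix f assume f: "f \<in> carrier Ind"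
    show "\<zero>\<^bsub>Ind\<^esub> \<oplus>\<^bsub>Ind\<^esub> f = f"
      by (rule induced_space_eqI[OF add_closed[OF zero_closed f] f]) (simp add: value_closed[OF f])
    show "\<exists>g\<in>carrier Ind. g \<oplus>\<^bsub>Ind\<^esub> f = \<zero>\<^bsub>Ind\<^esub>"
    proof
      show *: "(- 1) \<odot>\<^bsub>Ind\<^esub> f \<in> carrier Ind" by (rule smult_closed[OF f])
      show "(- 1) \<odot>\<^bsub>Ind\<^esub> f \<oplus>\<^bsub>Ind\<^esub> f = \<zero>\<^bsub>Ind\<^esub>"
      proof (rule induced_space_eqI[OF add_closed[OF * f] zero_closed])
        fix x assume x: "x \<in> carrier G"
        then show "((- 1) \<odot>\<^bsub>Ind\<^esub> f \<oplus>\<^bsub>Ind\<^esub> f) x = \<zero>\<^bsub>Ind\<^esub> x"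
          using value_closed[OF f x] W.smult_minus_1[of "f x"]
          by (simp add: class_ring_simps W.l_neg)
      qed
    qed
  qed (use closed in auto)
next
  note [simp del] = induced_space_simps(1)
  fix a b :: complex and f g assume fg: "f \<in> carrier Ind" "g \<in> carrier Ind"
  show "a \<odot>\<^bsub>Ind\<^esub> f \<in> carrier Ind" by (rule smult_closed[OF fg(1)])
  show "(a \<oplus>\<^bsub>class_ring\<^esub> b) \<odot>\<^bsub>Ind\<^esub> f = a \<odot>\<^bsub>Ind\<^esub> f \<oplus>\<^bsub>Ind\<^esub> b \<odot>\<^bsub>Ind\<^esub> f"
    using fg W.smult_l_distr[of a b]
    by (intro induced_space_eqI[of _ G H \<pi>] add_closed smult_closed) (simp_all add: value_closed)
  show "a \<odot>\<^bsub>Ind\<^esub> (f \<oplus>\<^bsub>Ind\<^esub> g) = a \<odot>\<^bsub>Ind\<^esub> f \<oplus>\<^bsub>Ind\<^esub> a \<odot>\<^bsub>Ind\<^esub> g"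
    using fg by (intro induced_space_eqI[of _ G H \<pi>] add_closed smult_closed)
      (simp_all add: value_closed W.smult_r_distr)
  show "(a \<otimes>\<^bsub>class_ring\<^esub> b) \<odot>\<^bsub>Ind\<^esub> f = a \<odot>\<^bsub>Ind\<^esub> (b \<odot>\<^bsub>Ind\<^esub> f)"
    using fg W.smult_assoc1[of a b]
    by (intro induced_space_eqI[of _ G H \<pi>] smult_closed) (simp_all add: value_closed)
  show "\<one>\<^bsub>class_ring\<^esub> \<odot>\<^bsub>Ind\<^esub> f = f"
    using fg W.smult_one
    by (intro induced_space_eqI[of _ G H \<pi>] smult_closed) (simp_all add: value_closed)
qed (rule class_cring.cring_axioms)

lemma evaluation_linear: "x \<in> carrier G \<Longrightarrow> (\<lambda>f. f x) \<in> linear_maps Ind (rep_space \<pi>)"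
  by (rule linear_mapI) auto

text \<open>
  The operations on functions are pointwise, so linearity into the induced space can be tested one
  value at a time.
\<close>

lemma linear_map_into_inducedI:
  assumes closed: "\<And>v. v \<in> carrier V \<Longrightarrow> F v \<in> carrier Ind"
    and lin: "\<And>x. x \<in> carrier G \<Longrightarrow> (\<lambda>v. F v x) \<in> linear_maps V (rep_space \<pi>)"
    and V: "complex_module V"
  shows "F \<in> linear_maps V Ind"
proof (rule linear_mapI)
  interpret V: Module.module class_ring V by (rule V)
  note [simp del] = induced_space_simps(1)
  fix u v assume uv: "u \<in> carrier V" "v \<in> carrier V"
  show "F (u \<oplus>\<^bsub>V\<^esub> v) = F u \<oplus>\<^bsub>Ind\<^esub> F v"
    using uv by (intro induced_space_eqI[of _ G H \<pi>] closed add_closed)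
      (simp_all add: linear_map_add[OF lin])
  have "c \<odot>\<^bsub>V\<^esub> v \<in> carrier V" for c
    using uv(2) by simp
  then show "F (c \<odot>\<^bsub>V\<^esub> v) = c \<odot>\<^bsub>Ind\<^esub> F v" for c
    using uv by (intro induced_space_eqI[of _ G H \<pi>] closed smult_closed)
      (simp_all add: linear_map_smult[OF lin])
qed (rule closed)

lemma translation_apply:
  "f \<in> carrier Ind \<Longrightarrow> rep_act (induced_rep G H \<pi>) g f = (\<lambda>x\<in>carrier G. f (x \<otimes> g))"
  by (simp add: induced_rep_def)

lemma translation_linear:
  assumes g: "g \<in> carrier G"
  shows "rep_act (induced_rep G H \<pi>) g \<in> linear_maps Ind Ind"
proof (rule linear_map_into_inducedI[OF _ _ induced_module])
  show "rep_act (induced_rep G H \<pi>) g f \<in> carrier Ind" if f: "f \<in> carrier Ind" for f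
    unfolding translation_apply[OF f]
  proof (rule restrict_in_inducedI)
    show "f (x \<otimes> g) \<in> carrier (rep_space \<pi>)" if "x \<in> carrier G" for x
      using f that g by (intro value_closed) simp_all
    fix h x assume h: "h \<in> H" and x: "x \<in> carrier G"
    show "f (h \<otimes> x \<otimes> g) = rep_act \<pi> h (f (x \<otimes> g))"
      using equivariant[OF f h, of "x \<otimes> g"] h x g H.subset by (simp add: m_assoc subset_iff)
  qed
  show "(\<lambda>f. rep_act (induced_rep G H \<pi>) g f x) \<in> linear_maps Ind (rep_space \<pi>)"
    if x: "x \<in> carrier G" for x
    by (rule linear_map_cong[OF induced_module evaluation_linear[of "x \<otimes> g"]])
      (use x g in \<open>simp_all add: translation_apply del: induced_space_simps\<close>)
qed

end

text \<open>
  The element \<open>\<delta>\<^sub>x\<^sub>,\<^sub>w\<close> of the induced space that is supported on the coset \<open>H x\<close> and has value \<open>w\<close> at \<open>x\<close>.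
  Equivariance leaves no other choice on that coset: its value at \<open>h x\<close> is \<open>\<pi> h w\<close>.
\<close>

definition coset_function ::
    "('g, 'm) monoid_scheme \<Rightarrow> 'g set \<Rightarrow> ('g, 'w) rep \<Rightarrow> 'g \<Rightarrow> 'w \<Rightarrow> 'g \<Rightarrow> 'w" where
  "coset_function G H \<pi> x w =
    (\<lambda>y\<in>carrier G. if y \<otimes>\<^bsub>G\<^esub> inv\<^bsub>G\<^esub> x \<in> H then rep_act \<pi> (y \<otimes>\<^bsub>G\<^esub> inv\<^bsub>G\<^esub> x) w
      else \<zero>\<^bsub>rep_space \<pi>\<^esub>)"

lemma (in induction) coset_function_linear:
  assumes mult: "\<And>g h w. g \<in> H \<Longrightarrow> h \<in> H \<Longrightarrow> w \<in> carrier (rep_space \<pi>) \<Longrightarrow>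
      rep_act \<pi> (g \<otimes> h) w = rep_act \<pi> g (rep_act \<pi> h w)"
    and x: "x \<in> carrier G"
  shows "coset_function G H \<pi> x \<in> linear_maps (rep_space \<pi>) Ind"
proof (rule linear_map_into_inducedI[OF _ _ W])
  interpret W: Module.module class_ring "rep_space \<pi>" by (rule W)
  fix w assume w: "w \<in> carrier (rep_space \<pi>)"
  show "coset_function G H \<pi> x w \<in> carrier Ind"
    unfolding coset_function_def
  proof (rule restrict_in_inducedI)
    fix h y assume h: "h \<in> H" and y: "y \<in> carrier G"
    have h': "h \<in> carrier G" using h H.subset by blast
    have assoc: "h \<otimes> y \<otimes> inv x = h \<otimes> (y \<otimes> inv x)"
      using h' x y by (simp add: m_assoc)
    \<comment> \<open>The support is a union of left \<open>H\<close>-orbits: multiplication by \<open>h\<close> neither leaves nor enters it.\<close>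
    have "y \<otimes> inv x \<in> H" if "h \<otimes> (y \<otimes> inv x) \<in> H"
    proof -
      have "inv h \<otimes> (h \<otimes> (y \<otimes> inv x)) \<in> H"
        using that h by simp
      then show ?thesis
        using h' x y by (simp flip: m_assoc)
    qed
    then have iff: "h \<otimes> y \<otimes> inv x \<in> H \<longleftrightarrow> y \<otimes> inv x \<in> H"
      using h by (auto simp: assoc)
    show "(if h \<otimes> y \<otimes> inv x \<in> H then rep_act \<pi> (h \<otimes> y \<otimes> inv x) w else \<zero>\<^bsub>rep_space \<pi>\<^esub>)
        = rep_act \<pi> h (if y \<otimes> inv x \<in> H then rep_act \<pi> (y \<otimes> inv x) w else \<zero>\<^bsub>rep_space \<pi>\<^esub>)"
      unfolding iff unfolding assoc using h w by (simp add: mult linear_map_zero[OF W W act])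
  qed (use w linear_map_closed[OF act] in auto)
next
  fix y assume y: "y \<in> carrier G"
  show "(\<lambda>w. coset_function G H \<pi> x w y) \<in> linear_maps (rep_space \<pi>) (rep_space \<pi>)"
    using y by (cases "y \<otimes> inv x \<in> H")
      (simp_all add: coset_function_def act linear_map_const_zero[OF W])
qed

section \<open>The projection formula\<close>

text \<open>
  There are exactly \<open>|H|\<close> elements \<open>x\<close> with \<open>y x\<inverse> \<in> H\<close>, namely those of the coset \<open>H y\<close>. Summing over
  all of \<open>G\<close> and dividing by \<open>|H|\<close> replaces a choice of coset representatives.
\<close>

lemma (in group) coset_average:
  assumes "subgroup H G" "finite (carrier G)" "complex_module V" "v \<in> carrier V" "y \<in> carrier G"
  shows "inverse (of_nat (card H)) \<odot>\<^bsub>V\<^esub>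
      (\<Oplus>\<^bsub>V\<^esub>x\<in>carrier G. if y \<otimes> inv x \<in> H then v else \<zero>\<^bsub>V\<^esub>) = v"
proof -
  interpret H: subgroup H G by fact
  interpret V: Module.module class_ring V by fact
  define K where "K = {x \<in> carrier G. y \<otimes> inv x \<in> H}"
  have fin: "finite H" using assms(2) H.subset by (rule rev_finite_subset)
  \<comment> \<open>The elements \<open>x\<close> that contribute at \<open>y\<close> are those of the form \<open>h\<inverse> y\<close>.\<close>
  have "bij_betw (\<lambda>x. y \<otimes> inv x) K H"
  proof (rule bij_betw_byWitness[where f' = "\<lambda>h. inv h \<otimes> y"])
    show "\<forall>x\<in>K. inv (y \<otimes> inv x) \<otimes> y = x"
      using assms(5) by (auto simp: K_def inv_mult_group m_assoc)
    show "\<forall>h\<in>H. y \<otimes> inv (inv h \<otimes> y) = h"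
      using assms(5) H.subset by (auto simp: inv_mult_group subset_iff simp flip: m_assoc)
    then show "(\<lambda>h. inv h \<otimes> y) ` H \<subseteq> K"
      using assms(5) H.subset by (auto simp: K_def subset_iff)
  qed (auto simp: K_def)
  then have card: "card K = card H" by (rule bij_betw_same_card)
  have "(\<Oplus>\<^bsub>V\<^esub>x\<in>carrier G. if y \<otimes> inv x \<in> H then v else \<zero>\<^bsub>V\<^esub>) = (\<Oplus>\<^bsub>V\<^esub>x\<in>K. v)"
    using assms(2,4) by (intro V.add.finprod_mono_neutral_cong_right) (auto simp: K_def)
  also have "\<dots> = of_nat (card H) \<odot>\<^bsub>V\<^esub> v"
    using complex_module_finsum_const[OF assms(3,4), of K] by (simp add: card)
  finally have sum: "(\<Oplus>\<^bsub>V\<^esub>x\<in>carrier G. if y \<otimes> inv x \<in> H then v else \<zero>\<^bsub>V\<^esub>)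
      = of_nat (card H) \<odot>\<^bsub>V\<^esub> v" .
  have "card H \<noteq> 0"
    using fin H.one_closed by (metis card_0_eq empty_iff)
  then have "inverse (of_nat (card H)) * of_nat (card H) = (1 :: complex)"
    by simp
  then show ?thesis
    using V.smult_assoc1[of "inverse (of_nat (card H))" "of_nat (card H)" v] V.smult_one[of v]
      assms(4) by (simp add: sum)
qed

text \<open>
  In the following locale, \<open>V\<close> and \<open>W\<close> are the spaces of \<open>\<T>\<close> and \<open>\<pi>\<close>, the representation \<open>\<rho>\<close> of \<open>H\<close> is
  \<open>\<T>|\<^sub>H \<otimes> \<pi>\<close>, and \<open>\<sigma>\<close> is \<open>\<T> \<otimes> Ind \<pi>\<close>. The instances \<open>I\<close> and \<open>J\<close> are the induced spaces of \<open>\<pi>\<close> and of \<open>\<rho>\<close>,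
  and \<open>VW\<close> and \<open>VI\<close> are the tensor products \<open>V \<otimes> W\<close> and \<open>V \<otimes> Ind \<pi>\<close>.
\<close>

locale projection_formula = group G + H: subgroup H G + \<T>: linear_action G \<T> +
  \<pi>: linear_action "G\<lparr>carrier := H\<rparr>" \<pi>
  for G :: "('g, 'm) monoid_scheme" (structure) and H :: "'g set"
    and \<T> :: "('g, 'v) rep" and \<pi> :: "('g, 'w) rep" +
  assumes finite: "finite (carrier G)"
begin

abbreviation V where "V \<equiv> rep_space \<T>"
abbreviation W where "W \<equiv> rep_space \<pi>"
abbreviation \<rho> where "\<rho> \<equiv> tensor_rep (restrict_rep H \<T>) \<pi>"
abbreviation \<sigma> where "\<sigma> \<equiv> tensor_rep \<T> (induced_rep G H \<pi>)"

lemma in_H: "h \<in> H \<Longrightarrow> h \<in> carrier G"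
  using H.subset by blast

lemma \<pi>_linear: "h \<in> H \<Longrightarrow> rep_act \<pi> h \<in> linear_maps W W"
  using \<pi>.act_linear by simp

lemma \<pi>_mult:
  "g \<in> H \<Longrightarrow> h \<in> H \<Longrightarrow> w \<in> carrier W \<Longrightarrow> rep_act \<pi> (g \<otimes> h) w = rep_act \<pi> g (rep_act \<pi> h w)"
  using \<pi>.act_mult by simp

sublocale VW: tensor_product V W
  by (rule tensor_product.intro[OF \<T>.space \<pi>.space])

sublocale I: induction G H \<pi>
  by (intro induction.intro induction_axioms.intro group_axioms H.subgroup_axioms \<pi>.space \<pi>_linear)

sublocale VI: tensor_product V I.Ind
  by (rule tensor_product.intro[OF \<T>.space I.induced_module])

lemma \<rho>_space: "rep_space \<rho> = VW.T"
  by (simp add: tensor_rep_def restrict_rep_def)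

lemma \<rho>_act: "h \<in> H \<Longrightarrow> rep_act \<rho> h = tensor_map V W (rep_act \<T> h) (rep_act \<pi> h)"
  by (simp add: tensor_rep_def restrict_rep_def)

lemma \<rho>_linear: "h \<in> H \<Longrightarrow> rep_act \<rho> h \<in> linear_maps VW.T VW.T"
  unfolding \<rho>_act by (intro VW.tensor_map_linear \<T>.act_linear \<pi>_linear in_H)

lemma \<rho>_pure:
  "h \<in> H \<Longrightarrow> v \<in> carrier V \<Longrightarrow> w \<in> carrier W \<Longrightarrow>
    rep_act \<rho> h (pure_tensor V W v w) = pure_tensor V W (rep_act \<T> h v) (rep_act \<pi> h w)"
  unfolding \<rho>_act by (intro VW.tensor_map_pure \<T>.act_linear \<pi>_linear in_H)

sublocale J: induction G H \<rho>
  by (intro induction.intro induction_axioms.intro group_axioms H.subgroup_axioms;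
      simp only: \<rho>_space VW.tensor_module \<rho>_linear)

lemma \<sigma>_space: "rep_space \<sigma> = VI.T"
  by (simp add: tensor_rep_def induced_rep_def)

lemma \<sigma>_act: "rep_act \<sigma> g = tensor_map V I.Ind (rep_act \<T> g) (rep_act (induced_rep G H \<pi>) g)"
  by (simp add: tensor_rep_def induced_rep_def)

lemma \<sigma>_linear: "g \<in> carrier G \<Longrightarrow> rep_act \<sigma> g \<in> linear_maps VI.T VI.T"
  unfolding \<sigma>_act by (intro VI.tensor_map_linear \<T>.act_linear I.translation_linear)

lemma \<sigma>_pure:
  "g \<in> carrier G \<Longrightarrow> v \<in> carrier V \<Longrightarrow> f \<in> carrier I.Ind \<Longrightarrow>
    rep_act \<sigma> g (pure_tensor V I.Ind v f) =
      pure_tensor V I.Ind (rep_act \<T> g v) (rep_act (induced_rep G H \<pi>) g f)"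
  unfolding \<sigma>_act by (intro VI.tensor_map_pure \<T>.act_linear I.translation_linear)

declare induced_space_simps(1) [simp del]

text \<open>
  Twisting the constant vector \<open>v\<close> by \<open>\<T> x\<close> turns it into an \<open>H\<close>-equivariant function of \<open>x\<close>, so that its
  product with the equivariant function \<open>f\<close> lies in the space induced from \<open>\<T>|\<^sub>H \<otimes> \<pi>\<close>.
\<close>

definition pointwise_tensor :: "'v \<Rightarrow> ('g \<Rightarrow> 'w) \<Rightarrow> 'g \<Rightarrow> ('v \<times> 'w \<Rightarrow>\<^sub>0 complex) set" where
  "pointwise_tensor v f = (\<lambda>x\<in>carrier G. pure_tensor V W (rep_act \<T> x v) (f x))"

lemma \<T>_closed: "x \<in> carrier G \<Longrightarrow> v \<in> carrier V \<Longrightarrow> rep_act \<T> x v \<in> carrier V"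
  by (rule linear_map_closed[OF \<T>.act_linear])

lemma pointwise_tensor_closed:
  assumes v: "v \<in> carrier V" and f: "f \<in> carrier I.Ind"
  shows "pointwise_tensor v f \<in> carrier J.Ind"
  unfolding pointwise_tensor_def
proof (rule J.restrict_in_inducedI)
  show "pure_tensor V W (rep_act \<T> x v) (f x) \<in> carrier (rep_space \<rho>)" if "x \<in> carrier G" for x
    using that v f by (simp add: \<rho>_space VW.pure_tensor_closed \<T>_closed I.value_closed)
  show "pure_tensor V W (rep_act \<T> (h \<otimes> x) v) (f (h \<otimes> x)) =
      rep_act \<rho> h (pure_tensor V W (rep_act \<T> x v) (f x))" if "h \<in> H" "x \<in> carrier G" for h x
    using that v f
    by (simp add: \<rho>_pure \<T>_closed I.value_closed I.equivariant \<T>.act_mult in_H)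
qed

lemma pointwise_tensor_bilinear: "bilinear V I.Ind J.Ind pointwise_tensor"
  unfolding bilinear_def
proof (intro conjI ballI)
  note pure = bilinearD[OF VW.pure_tensor_bilinear]
  fix f assume f: "f \<in> carrier I.Ind"
  show "(\<lambda>v. pointwise_tensor v f) \<in> linear_maps V J.Ind"
  proof (rule J.linear_map_into_inducedI[OF pointwise_tensor_closed[OF _ f] _ \<T>.space])
    fix x assume x: "x \<in> carrier G"
    show "(\<lambda>v. pointwise_tensor v f x) \<in> linear_maps V (rep_space \<rho>)"
      using linear_map_compose[OF \<T>.act_linear[OF x] pure(1)[OF I.value_closed[OF f x]]] x
      by (simp add: pointwise_tensor_def \<rho>_space)
  qed
next
  note pure = bilinearD[OF VW.pure_tensor_bilinear]
  fix v assume v: "v \<in> carrier V"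
  show "pointwise_tensor v \<in> linear_maps I.Ind J.Ind"
  proof (rule J.linear_map_into_inducedI[OF pointwise_tensor_closed[OF v] _ I.induced_module])
    fix x assume x: "x \<in> carrier G"
    show "(\<lambda>f. pointwise_tensor v f x) \<in> linear_maps I.Ind (rep_space \<rho>)"
      using linear_map_compose[OF I.evaluation_linear[OF x] pure(2)[OF \<T>_closed[OF x v]]] x
      by (simp add: pointwise_tensor_def \<rho>_space)
  qed
qed

definition tensor_to_induced where "tensor_to_induced = tensor_lift J.Ind pointwise_tensor"

lemmas tensor_to_induced_linear = VI.tensor_lift_linear[OF J.induced_module pointwise_tensor_bilinear, folded tensor_to_induced_def]
lemmas tensor_to_induced_pure = VI.tensor_lift_pure[OF J.induced_module pointwise_tensor_bilinear, folded tensor_to_induced_def]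

text \<open>
  For \<open>t\<close> in \<open>V \<otimes> W\<close>, this is the preimage under \<open>tensor_to_induced\<close> of the equivariant function that
  is supported on \<open>H x\<close> and has value \<open>t\<close> at \<open>x\<close>. The factor \<open>\<T> (x\<inverse>)\<close> undoes the twist of
  \<open>pointwise_tensor\<close> at \<open>x\<close>.
\<close>

definition coset_extension where
  "coset_extension x = tensor_lift VI.T
    (\<lambda>v w. pure_tensor V I.Ind (rep_act \<T> (inv x) v) (coset_function G H \<pi> x w))"

context
  fixes x assumes x: "x \<in> carrier G"
begin

lemmas coset_function_linear = I.coset_function_linear[OF \<pi>_mult x]

lemma coset_extension_bilinear:
  "bilinear V W VI.T
    (\<lambda>v w. pure_tensor V I.Ind (rep_act \<T> (inv x) v) (coset_function G H \<pi> x w))"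
  by (rule bilinear_compose[OF VI.pure_tensor_bilinear \<T>.act_linear[OF inv_closed[OF x]]
        coset_function_linear])

lemmas coset_extension_linear = VW.tensor_lift_linear[OF VI.tensor_module coset_extension_bilinear, folded coset_extension_def]
lemmas coset_extension_pure = VW.tensor_lift_pure[OF VI.tensor_module coset_extension_bilinear, folded coset_extension_def]

lemma tensor_to_induced_of_coset_extension:
  assumes t: "t \<in> carrier VW.T" and y: "y \<in> carrier G"
  shows "tensor_to_induced (coset_extension x t) y = (if y \<otimes> inv x \<in> H then rep_act \<rho> (y \<otimes> inv x) t else \<zero>\<^bsub>VW.T\<^esub>)"
    (is "_ = ?R t")
proof (rule VW.tensor_linear_ext[OF VW.tensor_module _ _ _ t])
  show "(\<lambda>t. tensor_to_induced (coset_extension x t) y) \<in> linear_maps VW.T VW.T"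
    using linear_map_compose[OF linear_map_compose[OF coset_extension_linear tensor_to_induced_linear] J.evaluation_linear[OF y]]
    by (simp add: \<rho>_space)
  show "?R \<in> linear_maps VW.T VW.T"
    by (cases "y \<otimes> inv x \<in> H")
      (simp_all only: if_True if_False \<rho>_linear linear_map_const_zero[OF VW.tensor_module])
  fix v w assume v: "v \<in> carrier V" and w: "w \<in> carrier W"
  have "tensor_to_induced (coset_extension x (pure_tensor V W v w)) y =
      pure_tensor V W (rep_act \<T> y (rep_act \<T> (inv x) v)) (coset_function G H \<pi> x w y)"
    using v w x y linear_map_closed[OF coset_function_linear w]
    by (simp add: coset_extension_pure tensor_to_induced_pure \<T>_closed pointwise_tensor_def)
  also have "rep_act \<T> y (rep_act \<T> (inv x) v) = rep_act \<T> (y \<otimes> inv x) v"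
    using v x y by (simp add: \<T>.act_mult)
  also have "pure_tensor V W (rep_act \<T> (y \<otimes> inv x) v) (coset_function G H \<pi> x w y) =
      ?R (pure_tensor V W v w)"
    using v w x y
      linear_map_zero[OF \<pi>.space VW.tensor_module
        bilinearD(2)[OF VW.pure_tensor_bilinear \<T>_closed[of "y \<otimes> inv x" v]]]
    by (simp add: coset_function_def \<rho>_pure)
  finally show "tensor_to_induced (coset_extension x (pure_tensor V W v w)) y = ?R (pure_tensor V W v w)" .
qed

end

text \<open>
  An equivariant function \<open>F\<close> is the sum of its restrictions to the cosets of \<open>H\<close>, and the restriction to
  \<open>H x\<close> is determined by \<open>F x\<close>. In the sum over \<open>G\<close> each coset is counted \<open>|H|\<close> times.
\<close>

definition induced_to_tensor where
  "induced_to_tensor F = inverse (of_nat (card H)) \<odot>\<^bsub>VI.T\<^esub> (\<Oplus>\<^bsub>VI.T\<^esub>x\<in>carrier G. coset_extension x (F x))"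

lemma value_J: "F \<in> carrier J.Ind \<Longrightarrow> x \<in> carrier G \<Longrightarrow> F x \<in> carrier VW.T"
  using J.value_closed by (simp add: \<rho>_space)

lemma coset_extension_value_linear:
  assumes "x \<in> carrier G"
  shows "(\<lambda>F. coset_extension x (F x)) \<in> linear_maps J.Ind VI.T"
  using linear_map_compose[OF J.evaluation_linear[OF assms], unfolded \<rho>_space, OF coset_extension_linear[OF assms]] .

lemma induced_to_tensor_linear: "induced_to_tensor \<in> linear_maps J.Ind VI.T"
  unfolding induced_to_tensor_def[abs_def]
  by (intro linear_map_scaled linear_map_finsum VI.tensor_module finite coset_extension_value_linear)

text \<open>
  The summand for \<open>x\<close> contributes at \<open>y\<close> only if \<open>y \<in> H x\<close>, and then it contributes
  \<open>\<rho> (y x\<inverse>) (F x) = F y\<close> by equivariance, whatever \<open>x\<close> is.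
\<close>

lemma tensor_to_induced_inverse:
  assumes F: "F \<in> carrier J.Ind"
  shows "tensor_to_induced (induced_to_tensor F) = F"
proof (rule induced_space_eqI)
  show "tensor_to_induced (induced_to_tensor F) \<in> carrier J.Ind"
    by (intro linear_map_closed[OF tensor_to_induced_linear] linear_map_closed[OF induced_to_tensor_linear] F)
  show "F \<in> carrier J.Ind" by (rule F)
  fix y assume y: "y \<in> carrier G"
  have value_y: "(\<lambda>t. tensor_to_induced t y) \<in> linear_maps VI.T VW.T"
    using linear_map_compose[OF tensor_to_induced_linear J.evaluation_linear[OF y]] by (simp add: \<rho>_space)
  have coset_extension: "coset_extension x (F x) \<in> carrier VI.T" if "x \<in> carrier G" for x
    by (rule linear_map_closed[OF coset_extension_value_linear[OF that] F])
  interpret VI: Module.module class_ring VI.T by (rule VI.tensor_module)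
  interpret VW: Module.module class_ring VW.T by (rule VW.tensor_module)
  have "tensor_to_induced (induced_to_tensor F) y = inverse (of_nat (card H)) \<odot>\<^bsub>VW.T\<^esub> tensor_to_induced (\<Oplus>\<^bsub>VI.T\<^esub>x\<in>carrier G. coset_extension x (F x)) y"
    unfolding induced_to_tensor_def using coset_extension by (intro linear_map_smult[OF value_y] VI.finsum_closed) auto
  also have "tensor_to_induced (\<Oplus>\<^bsub>VI.T\<^esub>x\<in>carrier G. coset_extension x (F x)) y = (\<Oplus>\<^bsub>VW.T\<^esub>x\<in>carrier G. tensor_to_induced (coset_extension x (F x)) y)"
    by (rule linear_map_of_finsum[OF VI.tensor_module VW.tensor_module value_y finite coset_extension])
  also have "\<dots> = (\<Oplus>\<^bsub>VW.T\<^esub>x\<in>carrier G. if y \<otimes> inv x \<in> H then F y else \<zero>\<^bsub>VW.T\<^esub>)"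
  proof (rule VW.finsum_cong')
    show "tensor_to_induced (coset_extension x (F x)) y = (if y \<otimes> inv x \<in> H then F y else \<zero>\<^bsub>VW.T\<^esub>)" if x: "x \<in> carrier G" for x
      using J.equivariant[OF F, of "y \<otimes> inv x" x] x y
      by (simp add: tensor_to_induced_of_coset_extension[OF x value_J[OF F x] y] m_assoc)
  qed (use value_J[OF F y] in auto)
  also have "inverse (of_nat (card H)) \<odot>\<^bsub>VW.T\<^esub> \<dots> = F y"
    by (rule coset_average[OF H.subgroup_axioms finite VW.tensor_module value_J[OF F y] y])
  finally show "tensor_to_induced (induced_to_tensor F) y = F y" .
qed

lemma sum_of_coset_functions:
  assumes f: "f \<in> carrier I.Ind"
  shows "inverse (of_nat (card H)) \<odot>\<^bsub>I.Ind\<^esub>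
      (\<Oplus>\<^bsub>I.Ind\<^esub>x\<in>carrier G. coset_function G H \<pi> x (f x)) = f" (is "?c \<odot>\<^bsub>I.Ind\<^esub> ?S = f")
proof (rule induced_space_eqI)
  interpret I': Module.module class_ring I.Ind by (rule I.induced_module)
  interpret W: Module.module class_ring W by (rule \<pi>.space)
  have \<delta>: "coset_function G H \<pi> x (f x) \<in> carrier I.Ind" if "x \<in> carrier G" for x
    by (rule linear_map_closed[OF coset_function_linear[OF that] I.value_closed[OF f that]])
  have S: "?S \<in> carrier I.Ind"
    using \<delta> by (intro I'.finsum_closed) auto
  show "?c \<odot>\<^bsub>I.Ind\<^esub> ?S \<in> carrier I.Ind" by (rule I.smult_closed[OF S])
  show "f \<in> carrier I.Ind" by (rule f)
  fix y assume y: "y \<in> carrier G"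
  have "(?c \<odot>\<^bsub>I.Ind\<^esub> ?S) y = ?c \<odot>\<^bsub>W\<^esub> ?S y"
    using y by simp
  also have "?S y = (\<Oplus>\<^bsub>W\<^esub>x\<in>carrier G. coset_function G H \<pi> x (f x) y)"
    by (rule linear_map_of_finsum[OF I.induced_module \<pi>.space I.evaluation_linear[OF y] finite \<delta>])
  also have "\<dots> = (\<Oplus>\<^bsub>W\<^esub>x\<in>carrier G. if y \<otimes> inv x \<in> H then f y else \<zero>\<^bsub>W\<^esub>)"
  proof (rule W.finsum_cong')
    show "coset_function G H \<pi> x (f x) y = (if y \<otimes> inv x \<in> H then f y else \<zero>\<^bsub>W\<^esub>)"
      if x: "x \<in> carrier G" for x
      using I.equivariant[OF f, of "y \<otimes> inv x" x] x y
      by (simp add: coset_function_def m_assoc)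
  qed (use I.value_closed[OF f y] in auto)
  also have "?c \<odot>\<^bsub>W\<^esub> \<dots> = f y"
    by (rule coset_average[OF H.subgroup_axioms finite \<pi>.space I.value_closed[OF f y] y])
  finally show "(?c \<odot>\<^bsub>I.Ind\<^esub> ?S) y = f y" .
qed

text \<open>
  On a pure tensor \<open>v \<otimes> f\<close> the two twists cancel: the summand for \<open>x\<close> is \<open>v \<otimes> \<delta>\<^sub>x\<^sub>,\<^sub>f\<^sub>x\<close>. The factor \<open>v\<close> comes
  out of the sum, and the \<open>\<delta>\<^sub>x\<^sub>,\<^sub>f\<^sub>x\<close> add up to \<open>|H|\<close> times \<open>f\<close>.
\<close>

lemma induced_to_tensor_inverse:
  assumes t: "t \<in> carrier VI.T"
  shows "induced_to_tensor (tensor_to_induced t) = t"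
proof (rule VI.tensor_linear_ext[OF VI.tensor_module
      linear_map_compose[OF tensor_to_induced_linear induced_to_tensor_linear] linear_map_id _ t])
  fix v f assume v: "v \<in> carrier V" and f: "f \<in> carrier I.Ind"
  interpret VI: Module.module class_ring VI.T by (rule VI.tensor_module)
  interpret I': Module.module class_ring I.Ind by (rule I.induced_module)
  note pure = bilinearD(2)[OF VI.pure_tensor_bilinear v]
  have \<delta>: "coset_function G H \<pi> x (f x) \<in> carrier I.Ind" if "x \<in> carrier G" for x
    by (rule linear_map_closed[OF coset_function_linear[OF that] I.value_closed[OF f that]])
  have "coset_extension x (tensor_to_induced (pure_tensor V I.Ind v f) x) = pure_tensor V I.Ind v (coset_function G H \<pi> x (f x))"
    if x: "x \<in> carrier G" for x
    using \<T>.act_mult[of "inv x" x v] \<T>.act_one x v f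
    by (simp add: tensor_to_induced_pure pointwise_tensor_def coset_extension_pure[OF x] \<T>_closed I.value_closed)
  then have "(\<Oplus>\<^bsub>VI.T\<^esub>x\<in>carrier G. coset_extension x (tensor_to_induced (pure_tensor V I.Ind v f) x)) =
      (\<Oplus>\<^bsub>VI.T\<^esub>x\<in>carrier G. pure_tensor V I.Ind v (coset_function G H \<pi> x (f x)))"
    using linear_map_closed[OF pure \<delta>] by (intro VI.finsum_cong') auto
  also have "\<dots> = pure_tensor V I.Ind v (\<Oplus>\<^bsub>I.Ind\<^esub>x\<in>carrier G. coset_function G H \<pi> x (f x))"
    by (rule linear_map_of_finsum[OF I.induced_module VI.tensor_module pure finite \<delta>, symmetric])
  finally have "induced_to_tensor (tensor_to_induced (pure_tensor V I.Ind v f)) = pure_tensor V I.Ind v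
      (inverse (of_nat (card H)) \<odot>\<^bsub>I.Ind\<^esub> (\<Oplus>\<^bsub>I.Ind\<^esub>x\<in>carrier G. coset_function G H \<pi> x (f x)))"
    using \<delta> by (simp only: induced_to_tensor_def) (intro linear_map_smult[OF pure, symmetric] I'.finsum_closed; auto)
  then show "induced_to_tensor (tensor_to_induced (pure_tensor V I.Ind v f)) = pure_tensor V I.Ind v f"
    by (simp only: sum_of_coset_functions[OF f])
qed

text \<open>
  Both sides send \<open>v \<otimes> f\<close> to the function \<open>x \<mapsto> \<T> (x g) v \<otimes> f (x g)\<close>.
\<close>

lemma tensor_to_induced_equivariant:
  assumes g: "g \<in> carrier G" and t: "t \<in> carrier VI.T"
  shows "tensor_to_induced (rep_act \<sigma> g t) = rep_act (induced_rep G H \<rho>) g (tensor_to_induced t)"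
proof (rule VI.tensor_linear_ext[OF J.induced_module
      linear_map_compose[OF \<sigma>_linear[OF g] tensor_to_induced_linear]
      linear_map_compose[OF tensor_to_induced_linear J.translation_linear[OF g]] _ t])
  fix v f assume v: "v \<in> carrier V" and f: "f \<in> carrier I.Ind"
  have gf: "rep_act (induced_rep G H \<pi>) g f \<in> carrier I.Ind"
    by (rule linear_map_closed[OF I.translation_linear[OF g] f])
  have "tensor_to_induced (rep_act \<sigma> g (pure_tensor V I.Ind v f)) =
      pointwise_tensor (rep_act \<T> g v) (rep_act (induced_rep G H \<pi>) g f)"
    by (simp only: \<sigma>_pure[OF g v f] tensor_to_induced_pure[OF \<T>_closed[OF g v] gf])
  also have "\<dots> = (\<lambda>x\<in>carrier G. pointwise_tensor v f (x \<otimes> g))"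
    unfolding pointwise_tensor_def I.translation_apply[OF f]
    by (rule restrict_ext) (use g v in \<open>simp add: \<T>.act_mult\<close>)
  also have "\<dots> = rep_act (induced_rep G H \<rho>) g (tensor_to_induced (pure_tensor V I.Ind v f))"
    by (simp only: tensor_to_induced_pure[OF v f] J.translation_apply[OF pointwise_tensor_closed[OF v f]])
  finally show "tensor_to_induced (rep_act \<sigma> g (pure_tensor V I.Ind v f)) =
      rep_act (induced_rep G H \<rho>) g (tensor_to_induced (pure_tensor V I.Ind v f))" .
qed

text \<open>
  The inverse of an equivariant bijection is equivariant, which avoids comparing the sums over \<open>G\<close>.
\<close>

lemma induced_to_tensor_equivariant:
  assumes g: "g \<in> carrier G" and F: "F \<in> carrier J.Ind"
  shows "induced_to_tensor (rep_act (induced_rep G H \<rho>) g F) = rep_act \<sigma> g (induced_to_tensor F)"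
proof -
  have induced_to_tensorF: "induced_to_tensor F \<in> carrier VI.T" by (rule linear_map_closed[OF induced_to_tensor_linear F])
  have "induced_to_tensor (rep_act (induced_rep G H \<rho>) g F) = induced_to_tensor (rep_act (induced_rep G H \<rho>) g (tensor_to_induced (induced_to_tensor F)))"
    by (simp only: tensor_to_induced_inverse[OF F])
  also have "\<dots> = induced_to_tensor (tensor_to_induced (rep_act \<sigma> g (induced_to_tensor F)))"
    by (simp only: tensor_to_induced_equivariant[OF g induced_to_tensorF])
  also have "\<dots> = rep_act \<sigma> g (induced_to_tensor F)"
    by (rule induced_to_tensor_inverse[OF linear_map_closed[OF \<sigma>_linear[OF g] induced_to_tensorF]])
  finally show ?thesis .
qed

lemma induced_tensor_isomorphic: "rep_isomorphic G (induced_rep G H \<rho>) \<sigma>"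
proof -
  have space: "rep_space (induced_rep G H \<rho>) = J.Ind"
    by (simp add: induced_rep_def)
  have "bij_betw induced_to_tensor (carrier J.Ind) (carrier VI.T)"
    by (rule bij_betw_byWitness[where f' = tensor_to_induced])
      (use tensor_to_induced_inverse induced_to_tensor_inverse linear_map_closed[OF induced_to_tensor_linear] linear_map_closed[OF tensor_to_induced_linear] in blast)+
  then show ?thesis
    unfolding rep_isomorphic_def space \<sigma>_space using induced_to_tensor_linear induced_to_tensor_equivariant by blast
qed

end

theorem lemma2p3:
  fixes G :: "('g, 'm) monoid_scheme"
    and H :: "'g set"
    and \<T> :: "('g, 'v) rep"
    and \<pi> :: "('g, 'w) rep"
  assumes "group G"
    and "finite (carrier G)"
    and "subgroup H G"
    and "linear_representation G \<T>"
    and "linear_representation (G\<lparr>carrier := H\<rparr>) \<pi>"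
  shows "rep_isomorphic G
    (induced_rep G H (tensor_rep (restrict_rep H \<T>) \<pi>))
    (tensor_rep \<T> (induced_rep G H \<pi>))"
proof -
  interpret projection_formula G H \<T> \<pi>
    using assms by (intro projection_formula.intro projection_formula_axioms.intro
        linear_representation_action)
  show ?thesis by (rule induced_tensor_isomorphic)
qed

end
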